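(* For any nonnegative integers $f$ and $\sigma$, there are $n$-vertex unweighted (directed or undirected) graphs $G=(V,E)$, vertex subsets $S\subseteq V$ with $|S|=\sigma$, and RPTSes $\pi$ on $G$ that are consistent, stable, and (in the undirected case) symmetric, such that the $f$-FT $S\times V$ preserver formed by overlaying all replacement paths $\pi(s,v\mid F)$ with $s\in S$, $v\in V$, $F\subseteq E$, $|F|\le f$, has $\Omega\left(n^{2-1/2^f}\sigma^{1/2^f}\right)$ edges.
   Context: A replacement path tiebreaking scheme (RPTS) on $G=(V,E)$ is a function $\pi(s,t\mid F)$, for vertices $s,t$ and $F\subseteq E$, such that for each fixed $F$, $\pi(s,t\mid F)$ is one particular shortest $s\leadsto t$ path in $G\setminus F$ (or $\emptyset$ if none exists). $\pi$ is consistent if for every $F$ and all vertices $s,t,u,v$, whenever $u$ precedes $v$ on $\pi(s,t\mid F)$, $\pi(u,v\mid F)$ is a contiguous subpath of $\pi(s,t\mid F)$. $\pi$ is stable if for all $s,t,F$ and every edge $f'\notin\pi(s,t\mid F)$, $\pi(s,t\mid F)=\pi(s,t\mid F\cup\{f'\})$. $\pi$ is symmetric if $\pi(s,t\mid F)=\pi(t,s\mid F)$ for all $s,t,F$. An $f$-FT $S\times V$ preserver of $G$ is a subgraph $H$ with $\mathrm{dist}_{H\setminus F}(s,t)=\mathrm{dist}_{G\setminus F}(s,t)$ for all $s\in S$, $t\in V$, $F\subseteq E$ with $|F|\le f$. *)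

theory Defs
  imports Complex_Main "HOL-Library.Extended_Nat" "HOL-Library.Sublist"
begin

text \<open>
  Directed and undirected graphs are treated uniformly: a graph is a vertex set \<open>V\<close> together with
  an edge set \<open>E\<close>, and a function \<open>ed\<close> maps a step from \<open>u\<close> to \<open>v\<close> to the edge it traverses.
  For digraphs \<open>ed\<close> is \<open>Pair\<close>; for undirected graphs it is \<open>uedge\<close>.
\<close>

definition digraph :: "'v set \<Rightarrow> ('v \<times> 'v) set \<Rightarrow> bool" where
  "digraph V E \<longleftrightarrow> finite V \<and> E \<subseteq> V \<times> V \<and> (\<forall>v. (v, v) \<notin> E)"

definition ugraph :: "'v set \<Rightarrow> 'v set set \<Rightarrow> bool" where
  "ugraph V E \<longleftrightarrow> finite V \<and> (\<forall>e\<in>E. e \<subseteq> V \<and> card e = 2)"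

definition uedge :: "'v \<Rightarrow> 'v \<Rightarrow> 'v set" where
  "uedge u v = {u, v}"

text \<open>Paths are given by their vertex sequences; \<open>[]\<close> stands for the absent path.\<close>

definition path_edges :: "('v \<Rightarrow> 'v \<Rightarrow> 'e) \<Rightarrow> 'v list \<Rightarrow> 'e set" where
  "path_edges ed p = {ed (p ! i) (p ! Suc i) | i. Suc i < length p}"

definition is_path :: "('v \<Rightarrow> 'v \<Rightarrow> 'e) \<Rightarrow> 'v set \<Rightarrow> 'e set \<Rightarrow> 'v \<Rightarrow> 'v \<Rightarrow> 'v list \<Rightarrow> bool" where
  "is_path ed V E s t p \<longleftrightarrow>
     p \<noteq> [] \<and> hd p = s \<and> last p = t \<and> distinct p \<and> set p \<subseteq> V \<and> path_edges ed p \<subseteq> E"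

text \<open>The infimum of the empty set is \<open>\<infinity>\<close>, the distance between disconnected vertices.\<close>

definition graph_dist :: "('v \<Rightarrow> 'v \<Rightarrow> 'e) \<Rightarrow> 'v set \<Rightarrow> 'e set \<Rightarrow> 'v \<Rightarrow> 'v \<Rightarrow> enat" where
  "graph_dist ed V E s t = (INF p \<in> {p. is_path ed V E s t p}. enat (length p - 1))"

definition is_shortest_path ::
    "('v \<Rightarrow> 'v \<Rightarrow> 'e) \<Rightarrow> 'v set \<Rightarrow> 'e set \<Rightarrow> 'v \<Rightarrow> 'v \<Rightarrow> 'v list \<Rightarrow> bool" where
  "is_shortest_path ed V E s t p \<longleftrightarrow>
     is_path ed V E s t p \<and> enat (length p - 1) = graph_dist ed V E s t"

type_synonym ('v, 'e) scheme = "'v \<Rightarrow> 'v \<Rightarrow> 'e set \<Rightarrow> 'v list"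

definition rpts ::
    "('v \<Rightarrow> 'v \<Rightarrow> 'e) \<Rightarrow> 'v set \<Rightarrow> 'e set \<Rightarrow> ('v, 'e) scheme \<Rightarrow> bool" where
  "rpts ed V E \<pi> \<longleftrightarrow>
     (\<forall>F\<subseteq>E. \<forall>s\<in>V. \<forall>t\<in>V.
        if \<exists>p. is_path ed V (E - F) s t p
        then is_shortest_path ed V (E - F) s t (\<pi> s t F)
        else \<pi> s t F = [])"

definition precedes :: "'v list \<Rightarrow> 'v \<Rightarrow> 'v \<Rightarrow> bool" where
  "precedes p u v \<longleftrightarrow> (\<exists>i j. i < j \<and> j < length p \<and> p ! i = u \<and> p ! j = v)"

definition rpts_consistent :: "'v set \<Rightarrow> 'e set \<Rightarrow> ('v, 'e) scheme \<Rightarrow> bool" where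
  "rpts_consistent V E \<pi> \<longleftrightarrow>
     (\<forall>F\<subseteq>E. \<forall>s\<in>V. \<forall>t\<in>V. \<forall>u\<in>V. \<forall>v\<in>V.
        precedes (\<pi> s t F) u v \<longrightarrow> sublist (\<pi> u v F) (\<pi> s t F))"

definition rpts_stable ::
    "('v \<Rightarrow> 'v \<Rightarrow> 'e) \<Rightarrow> 'v set \<Rightarrow> 'e set \<Rightarrow> ('v, 'e) scheme \<Rightarrow> bool" where
  "rpts_stable ed V E \<pi> \<longleftrightarrow>
     (\<forall>F\<subseteq>E. \<forall>s\<in>V. \<forall>t\<in>V. \<forall>f'\<in>E.
        f' \<notin> path_edges ed (\<pi> s t F) \<longrightarrow> \<pi> s t F = \<pi> s t (F \<union> {f'}))"

text \<open>
  An undirected path read from either end is the same path; on vertex sequences this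
  identification is reversal.
\<close>

definition rpts_symmetric :: "'v set \<Rightarrow> 'e set \<Rightarrow> ('v, 'e) scheme \<Rightarrow> bool" where
  "rpts_symmetric V E \<pi> \<longleftrightarrow> (\<forall>F\<subseteq>E. \<forall>s\<in>V. \<forall>t\<in>V. \<pi> s t F = rev (\<pi> t s F))"

text \<open>The preserver is the subgraph with vertex set \<open>V\<close> and edge set \<open>H\<close>.\<close>

definition ft_preserver ::
    "('v \<Rightarrow> 'v \<Rightarrow> 'e) \<Rightarrow> nat \<Rightarrow> 'v set \<Rightarrow> 'e set \<Rightarrow> 'v set \<Rightarrow> 'e set \<Rightarrow> bool" where
  "ft_preserver ed f V E S H \<longleftrightarrow>
     H \<subseteq> E \<and>
     (\<forall>s\<in>S. \<forall>t\<in>V. \<forall>F\<subseteq>E. card F \<le> f \<longrightarrow>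
        graph_dist ed V (H - F) s t = graph_dist ed V (E - F) s t)"

definition overlay ::
    "('v \<Rightarrow> 'v \<Rightarrow> 'e) \<Rightarrow> nat \<Rightarrow> 'v set \<Rightarrow> 'e set \<Rightarrow> 'v set \<Rightarrow> ('v, 'e) scheme \<Rightarrow> 'e set" where
  "overlay ed f V E S \<pi> =
     (\<Union>s\<in>S. \<Union>v\<in>V. \<Union>F\<in>{F. F \<subseteq> E \<and> card F \<le> f}. path_edges ed (\<pi> s v F))"

end

theory Submission
  imports Defs "HOL-Library.Nat_Bijection"
begin

text \<open>
  Perturb unit edge lengths by distinct, tiny powers of two. All paths with common ends then have
  distinct weights, and choosing the lightest path is consistent, stable and, in the undirected
  case, symmetric. The order of the perturbations remains free, and it is chosen adversarially.

  Let the leaves of the trie \<open>T\<^sub>f\<close> be the strings \<open>1\<^sup>i 0\<^bsup>d-i\<^esup> z\<close> with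
  \<open>i < d = q\<^bsup>2^(f-1)\<^esup>\<close> and \<open>z\<close> a leaf of \<open>T\<^bsub>f-1\<^esub>\<close>. All leaves have the same
  depth, there are \<open>q\<^bsup>2^f-1\<^esup>\<close> of them among \<open>O(q\<^bsup>2^f\<^esup>)\<close> vertices, and cutting, on each of the
  \<open>f\<close> levels, the edge at which the next larger \<open>i\<close> continues disconnects all leaves that are
  lexicographically later than a given one. Join every leaf of about \<open>\<sigma>\<close> disjoint copies of the
  trie to every vertex of a set \<open>X\<close> of about \<open>n/2\<close> vertices, and let the perturbations of these
  edges decrease in the lexicographic order of the leaves and dominate those of the tree edges.
  For every leaf there are then \<open>f\<close> faults after which the chosen path from its root to any
  \<open>x \<in> X\<close> passes through this leaf, so every edge at \<open>X\<close> is used; for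
  \<open>q\<^bsup>2^f\<^esup> \<approx> n/\<sigma>\<close> this gives the bound.
\<close>

section \<open>Lightest paths\<close>

fun path_weight :: "('v \<Rightarrow> 'v \<Rightarrow> 'e) \<Rightarrow> ('e \<Rightarrow> nat) \<Rightarrow> 'v list \<Rightarrow> nat" where
  "path_weight ed w (x # y # p) = w (ed x y) + path_weight ed w (y # p)"
| "path_weight ed w p = 0"

lemma path_edges_Nil [simp]: "path_edges ed [] = {}"
  and path_edges_single [simp]: "path_edges ed [x] = {}"
  by (auto simp: path_edges_def)

lemma path_edges_Cons [simp]:
  "path_edges ed (x # y # p) = insert (ed x y) (path_edges ed (y # p))"
proof (intro equalityI subsetI)
  fix e
  assume "e \<in> path_edges ed (x # y # p)"
  then obtain i where "Suc i < length (x # y # p)" "e = ed ((x # y # p) ! i) ((x # y # p) ! Suc i)"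
    unfolding path_edges_def by blast
  then show "e \<in> insert (ed x y) (path_edges ed (y # p))"
    by (cases i) (auto simp: path_edges_def)
next
  fix e
  assume "e \<in> insert (ed x y) (path_edges ed (y # p))"
  then consider "e = ed x y" | i where "Suc i < length (y # p)" "e = ed ((y # p) ! i) ((y # p) ! Suc i)"
    unfolding path_edges_def by blast
  then show "e \<in> path_edges ed (x # y # p)"
  proof cases
    case 1
    then show ?thesis
      unfolding path_edges_def by (intro CollectI exI[of _ 0]) simp
  next
    case (2 i)
    then show ?thesis
      unfolding path_edges_def by (intro CollectI exI[of _ "Suc i"]) simp
  qed
qed

lemma path_edges_append:
  "path_edges ed (a @ u # b) = path_edges ed (a @ [u]) \<union> path_edges ed (u # b)"
proof (induction a)
  case (Cons x a)
  then show ?case by (cases a) auto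
qed simp

lemma path_edges_rev:
  assumes "\<And>u v. ed u v = ed v u"
  shows "path_edges ed (rev p) = path_edges ed p"
proof (induction p)
  case (Cons x p)
  then show ?case
  proof (cases p)
    case (Cons y q)
    then have "path_edges ed (rev (x # p)) = path_edges ed (rev p) \<union> path_edges ed [y, x]"
      using path_edges_append[of ed "rev q" y "[x]"] by simp
    then show ?thesis
      using Cons Cons.IH assms[of x y] by auto
  qed simp
qed simp

lemma path_edges_vertices:
  assumes "e \<in> path_edges ed p"
  obtains u v where "u \<in> set p" "v \<in> set p" "e = ed u v"
  proof -
  obtain i where "Suc i < length p" "e = ed (p ! i) (p ! Suc i)"
    using assms unfolding path_edges_def by auto
  then show thesis
    using that[of "p ! i" "p ! Suc i"] by simp
qed

lemma finite_path_edges [simp]: "finite (path_edges ed p)"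
  by (induction p rule: induct_list012) auto

lemma path_weight_append:
  "path_weight ed w (a @ u # b) = path_weight ed w (a @ [u]) + path_weight ed w (u # b)"
proof (induction a)
  case (Cons x a)
  then show ?case by (cases a) auto
qed simp

text \<open>Cutting out the closed stretch between two visits of a vertex keeps both ends and,
  weights being natural numbers, cannot raise the weight. This repairs the walks that arise when one
  path is spliced into another.\<close>

lemma walk_contains_path:
  assumes "p \<noteq> []" "set p \<subseteq> V" "path_edges ed p \<subseteq> E"
  shows "\<exists>q. is_path ed V E (hd p) (last p) q \<and> path_weight ed w q \<le> path_weight ed w p"
  using assms
proof (induction "length p" arbitrary: p rule: less_induct)
  case less
  show ?case
  proof (cases "distinct p")
    case True
    then show ?thesis
      using less.prems by (auto simp: is_path_def)
  next
    case False
    then obtain xs ys zs y where p: "p = xs @ [y] @ ys @ [y] @ zs"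
      using not_distinct_decomp by blast
    define r where "r = xs @ [y] @ zs"
    have "path_edges ed p = path_edges ed (xs @ [y]) \<union> path_edges ed (y # ys @ [y])
        \<union> path_edges ed (y # zs)"
      using path_edges_append[of ed xs y "ys @ y # zs"] path_edges_append[of ed "y # ys" y zs]
      by (auto simp: p)
    then have edges: "path_edges ed r \<subseteq> E"
      using path_edges_append[of ed xs y zs] less.prems by (simp add: r_def)
    have weight: "path_weight ed w r \<le> path_weight ed w p"
      using path_weight_append[of ed w xs y "ys @ y # zs"] path_weight_append[of ed w "y # ys" y zs]
        path_weight_append[of ed w xs y zs]
      by (simp add: p r_def)
    have "length r < length p" "r \<noteq> []" "set r \<subseteq> V" "hd r = hd p" "last r = last p"
      using less.prems by (auto simp: r_def p hd_append)
    then obtain q where "is_path ed V E (hd p) (last p) q" "path_weight ed w q \<le> path_weight ed w r"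
      using less.hyps[of r] edges by auto
    then show ?thesis
      using weight by (intro exI[of _ q]) simp
  qed
qed

text \<open>A simple path has only one edge at its first vertex, so the edge set reveals the second
  vertex, and induction gives the rest. The hypothesis on \<open>ed\<close> holds for
  \<open>Pair\<close> and for \<open>uedge\<close>.\<close>

lemma distinct_edges_determine_path:
  assumes ed_eq: "\<And>u v u' v'. ed u v = ed u' v' \<Longrightarrow> u = u' \<and> v = v' \<or> u = v' \<and> v = u'"
    and "p \<noteq> []" "q \<noteq> []" "distinct p" "distinct q" "hd p = hd q"
    and "path_edges ed p = path_edges ed q"
  shows "p = q"
  using assms(2-)
proof (induction p arbitrary: q rule: induct_list012)
  case (2 x)
  then show ?case
    by (cases q; cases "tl q") auto
next
  case (3 x y p)
  then obtain y' q' where q: "q = x # y' # q'"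
    by (cases q; cases "tl q") auto
  \<comment> \<open>No edge at \<open>x\<close> recurs once \<open>x\<close> has been left, so
    deleting the first edge leaves exactly the edges of the tail.\<close>
  have notin: "ed x a \<notin> path_edges ed l" if "x \<notin> set l" for a l
    using that ed_eq by (metis path_edges_vertices)
  have "ed x y \<in> path_edges ed q"
    using 3(8) by auto
  then have "ed x y = ed x y'"
    using notin[of "y' # q'" y] 3(6) q by auto
  then have y: "y = y'"
    using ed_eq 3(5) by fastforce
  have "path_edges ed (y # p) = path_edges ed (x # y # p) - {ed x y}"
    using notin[of "y # p" y] 3(5) by auto
  also have "\<dots> = path_edges ed q - {ed x y'}"
    using 3(8) y by simp
  also have "\<dots> = path_edges ed (y' # q')"
    using notin[of "y' # q'" y'] 3(6) q by auto
  finally have "y # p = y' # q'"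
    using 3 y q by (intro "3.IH"(2)) auto
  then show ?case
    using q by simp
qed simp

text \<open>\<open>ed_eq\<close> covers directed and undirected edges alike.
  \<open>weight_inj\<close> makes the minimum unique; \<open>weight_card\<close> forces lightest
  paths to have fewest edges.\<close>

locale weighted_graph =
  fixes ed :: "'v \<Rightarrow> 'v \<Rightarrow> 'e" and V :: "'v set" and E :: "'e set" and w :: "'e \<Rightarrow> nat"
  assumes finite_V: "finite V" and finite_E: "finite E"
    and ed_eq: "\<And>u v u' v'. ed u v = ed u' v' \<Longrightarrow> u = u' \<and> v = v' \<or> u = v' \<and> v = u'"
    and weight_inj: "inj_on (sum w) (Pow E)"
    and weight_card: "\<And>A B. A \<subseteq> E \<Longrightarrow> B \<subseteq> E \<Longrightarrow> card A < card B \<Longrightarrow> sum w A < sum w B"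
begin

definition lightest :: "('v, 'e) scheme" where
  "lightest s t F =
    (if \<exists>p. is_path ed V (E - F) s t p
     then ARG_MIN (path_weight ed w) p. is_path ed V (E - F) s t p else [])"

lemma path_edges_distinct:
  assumes "distinct p"
  shows path_weight_eq_sum: "path_weight ed w p = sum w (path_edges ed p)"
    and card_path_edges: "card (path_edges ed p) = length p - 1"
proof -
  have "path_weight ed w p = sum w (path_edges ed p) \<and> card (path_edges ed p) = length p - 1"
    using assms
  proof (induction p rule: induct_list012)
    case (3 x y p)
    have "ed x y \<notin> path_edges ed (y # p)"
      using 3(3) ed_eq by (metis distinct.simps(2) path_edges_vertices)
    then show ?case
      using 3 by simp
  qed auto
  then show "path_weight ed w p = sum w (path_edges ed p)"
    and "card (path_edges ed p) = length p - 1" by auto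
qed

text \<open>The weight determines the edge set, and the edge set together with the first vertex
  determines the path.\<close>

lemma path_weight_inj:
  assumes "is_path ed V (E - F) s t p" "is_path ed V (E - F) s t q"
    and "path_weight ed w p = path_weight ed w q"
  shows "p = q"
proof -
  have "sum w (path_edges ed p) = sum w (path_edges ed q)"
    using assms by (simp add: is_path_def path_weight_eq_sum)
  then have "path_edges ed p = path_edges ed q"
    using assms(1,2) by (intro inj_onD[OF weight_inj]) (auto simp: is_path_def)
  then show ?thesis
    using assms distinct_edges_determine_path[where ed = ed and p = p and q = q] ed_eq by (auto simp: is_path_def)
qed

lemma lightest_path:
  assumes "is_path ed V (E - F) s t q"
  shows lightest_is_path: "is_path ed V (E - F) s t (lightest s t F)"
    and lightest_le: "path_weight ed w (lightest s t F) \<le> path_weight ed w q"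
proof -
  have eq: "lightest s t F = (ARG_MIN (path_weight ed w) p. is_path ed V (E - F) s t p)"
    using assms by (auto simp: lightest_def)
  show "is_path ed V (E - F) s t (lightest s t F)"
    "path_weight ed w (lightest s t F) \<le> path_weight ed w q"
    unfolding eq
    using arg_min_nat_lemma[of "is_path ed V (E - F) s t" q "path_weight ed w"] assms by auto
qed

lemma lightest_eqI:
  assumes "is_path ed V (E - F) s t p"
    and "\<And>q. is_path ed V (E - F) s t q \<Longrightarrow> path_weight ed w p \<le> path_weight ed w q"
  shows "lightest s t F = p"
proof (rule path_weight_inj)
  show "is_path ed V (E - F) s t (lightest s t F)"
    using lightest_is_path[OF assms(1)] .
  then show "path_weight ed w (lightest s t F) = path_weight ed w p"
    using assms lightest_le[OF assms(1)] by (intro antisym) auto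
qed (rule assms(1))

lemma lightest_length:
  assumes "is_path ed V (E - F) s t q"
  shows "length (lightest s t F) \<le> length q"
proof (rule ccontr)
  assume neg: "\<not> ?thesis"
  let ?p = "lightest s t F"
  have p: "is_path ed V (E - F) s t ?p"
    using lightest_is_path[OF assms] .
  \<comment> \<open>The truncated subtraction in \<open>length q - 1\<close> is strictly monotone
    only above length 0.\<close>
  have "q \<noteq> []"
    using assms by (simp add: is_path_def)
  then have "length q - 1 < length ?p - 1"
    using neg by (simp add: diff_less_mono Suc_leI)
  then have "card (path_edges ed q) < card (path_edges ed ?p)"
    using p assms by (simp add: card_path_edges is_path_def)
  then have "sum w (path_edges ed q) < sum w (path_edges ed ?p)"
    using p assms by (intro weight_card) (auto simp: is_path_def)
  then show False
    using lightest_le[OF assms] p assms by (simp add: path_weight_eq_sum is_path_def)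
qed

lemma lightest_shortest:
  assumes "is_path ed V (E - F) s t q"
  shows "is_shortest_path ed V (E - F) s t (lightest s t F)"
proof -
  have "enat (length (lightest s t F) - 1) = graph_dist ed V (E - F) s t"
    unfolding graph_dist_def
  proof (rule antisym)
    show "enat (length (lightest s t F) - 1) \<le> (INF p\<in>{p. is_path ed V (E - F) s t p}. enat (length p - 1))"
      by (intro INF_greatest) (auto dest: lightest_length intro: diff_le_mono)
    show "(INF p\<in>{p. is_path ed V (E - F) s t p}. enat (length p - 1)) \<le> enat (length (lightest s t F) - 1)"
      using lightest_is_path[OF assms] by (intro INF_lower) auto
  qed
  then show ?thesis
    using lightest_is_path[OF assms] by (simp add: is_shortest_path_def)
qed

lemma lightest_Nil: "\<nexists>p. is_path ed V (E - F) s t p \<Longrightarrow> lightest s t F = []"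
  unfolding lightest_def by (rule if_not_P)

lemma lightest_edges: "path_edges ed (lightest s t F) \<subseteq> E - F"
proof (cases "\<exists>p. is_path ed V (E - F) s t p")
  case True
  then show ?thesis
    using lightest_is_path unfolding is_path_def by blast
qed (simp add: lightest_Nil)

lemma rpts_lightest: "rpts ed V E lightest"
  unfolding rpts_def using lightest_shortest lightest_Nil by auto

text \<open>A new fault only removes candidates, and the old minimum stays one as long as it avoids
  the fault; by uniqueness it is still the choice.\<close>

lemma stable_lightest: "rpts_stable ed V E lightest"
  unfolding rpts_stable_def
proof (intro allI ballI impI)
  fix F s t f'
  assume f': "f' \<notin> path_edges ed (lightest s t F)"
  have mono: "is_path ed V (E - F) s t p" if "is_path ed V (E - (F \<union> {f'})) s t p" for p
    using that by (auto simp: is_path_def)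
  show "lightest s t F = lightest s t (F \<union> {f'})"
  proof (cases "\<exists>p. is_path ed V (E - F) s t p")
    case True
    then have "is_path ed V (E - (F \<union> {f'})) s t (lightest s t F)"
      using f' lightest_is_path[of F s t] by (auto simp: is_path_def)
    then show ?thesis
      using lightest_le[OF mono] by (intro lightest_eqI[symmetric]) blast+
  next
    case False
    then show ?thesis
      using mono lightest_Nil by metis
  qed
qed

lemma consistent_lightest: "rpts_consistent V E lightest"
  unfolding rpts_consistent_def
proof (intro allI ballI impI)
  fix F s t u v
  let ?p = "lightest s t F"
  assume "precedes ?p u v"
  then obtain i j where ij: "i < j" "j < length ?p" "?p ! i = u" "?p ! j = v"
    by (auto simp: precedes_def)
  define a c where "a = take i ?p" and "c = drop (Suc j) ?p"
  define m where "m = take (Suc j - i) (drop i ?p)"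
  have m_ne: "m \<noteq> []"
    using ij by (auto simp: m_def)
  have p_amc: "?p = a @ m @ c"
  proof -
    have "drop i ?p = m @ drop (Suc j - i) (drop i ?p)"
      unfolding m_def by (rule append_take_drop_id[symmetric])
    also have "drop (Suc j - i) (drop i ?p) = c"
      using ij by (simp add: c_def)
    finally show ?thesis
      unfolding a_def by (metis append_take_drop_id)
  qed
  have hd_m: "hd m = u"
    using ij by (simp add: m_def hd_drop_conv_nth hd_take)
  have last_m: "last m = v"
  proof -
    have "last m = m ! (Suc j - i - 1)"
      using ij m_ne by (simp add: last_conv_nth m_def min_absorb2)
    also have "\<dots> = ?p ! j"
      using ij by (simp add: m_def)
    finally show ?thesis
      using ij by simp
  qed
  have ex: "\<exists>p. is_path ed V (E - F) s t p"
    using ij lightest_Nil[of F s t] by fastforce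
  then have p: "is_path ed V (E - F) s t ?p"
    using lightest_is_path by blast
  text \<open>Exchange argument: a lighter path from \<open>u\<close> to \<open>v\<close> in place of \<open>m\<close> would give a lighter walk,
    hence a lighter path, from \<open>s\<close> to \<open>t\<close>.\<close>
  have split: "path_edges ed (a @ r @ c)
        = path_edges ed (a @ [u]) \<union> path_edges ed r \<union> path_edges ed (v # c) \<and>
      path_weight ed w (a @ r @ c)
        = path_weight ed w (a @ [u]) + path_weight ed w r + path_weight ed w (v # c)"
    if r: "r \<noteq> []" "hd r = u" "last r = v" for r
  proof -
    obtain r1 where r1: "r = u # r1"
      using r by (cases r) auto
    obtain r2 where r2: "r = r2 @ [v]"
      using r by (metis append_butlast_last_id)
    have eqs: "a @ r @ c = a @ u # (r1 @ c)" "u # (r1 @ c) = r2 @ v # c"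
      using r1 r2 by auto
    show ?thesis
      unfolding eqs(1) path_edges_append[of ed a u "r1 @ c"] path_weight_append[of ed w a u "r1 @ c"]
      unfolding eqs(2) path_edges_append[of ed r2 v c] path_weight_append[of ed w r2 v c]
      unfolding r2 by auto
  qed
  have m: "is_path ed V (E - F) u v m"
  proof -
    have "distinct (a @ m @ c)" "set (a @ m @ c) \<subseteq> V" "path_edges ed (a @ m @ c) \<subseteq> E - F"
      using p unfolding is_path_def p_amc[symmetric] by blast+
    then have "distinct m" "set m \<subseteq> V" "path_edges ed m \<subseteq> E - F"
      using split[OF m_ne hd_m last_m] by auto
    then show ?thesis
      using m_ne hd_m last_m by (simp add: is_path_def)
  qed
  have "lightest u v F = m"
  proof (rule lightest_eqI[OF m])
    fix q
    assume q: "is_path ed V (E - F) u v q"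
    then have q': "q \<noteq> []" "hd q = u" "last q = v"
      by (auto simp: is_path_def)
    let ?r = "a @ q @ c"
    have "path_edges ed ?p \<subseteq> E - F" "set ?p \<subseteq> V"
      using p by (auto simp: is_path_def)
    then have edges: "path_edges ed ?r \<subseteq> E - F" and "set ?r \<subseteq> V"
      using split[OF q'] split[OF m_ne hd_m last_m] q p_amc
      by (auto simp: is_path_def)
    moreover have "hd ?r = s" "last ?r = t"
    proof -
      have "hd (a @ m @ c) = s" "last (a @ m @ c) = t"
        using p p_amc by (auto simp: is_path_def)
      then show "hd ?r = s" "last ?r = t"
        using q' m_ne hd_m last_m by (auto simp: hd_append last_append split: if_splits)
    qed
    \<comment> \<open>\<open>q\<close> may meet \<open>a\<close> or \<open>c\<close>, so the spliced
      sequence is only a walk; a simple path that is no heavier has to be extracted from it.\<close>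
    ultimately obtain r' where "is_path ed V (E - F) s t r'" "path_weight ed w r' \<le> path_weight ed w ?r"
      using walk_contains_path[of ?r V ed "E - F" w] q' by auto
    then have "path_weight ed w (a @ m @ c) \<le> path_weight ed w ?r"
      using lightest_le p_amc by (metis le_trans)
    then show "path_weight ed w m \<le> path_weight ed w q"
      using split[OF q'] split[OF m_ne hd_m last_m] by simp
  qed
  then show "sublist (lightest u v F) ?p"
    using p_amc by (metis sublist_appendI)
qed

lemma path_weight_rev:
  assumes "\<And>u v. ed u v = ed v u"
  shows "distinct p \<Longrightarrow> path_weight ed w (rev p) = path_weight ed w p"
  using path_edges_rev[of ed p, OF assms] by (simp add: path_weight_eq_sum)

text \<open>Reversal preserves the edge set, hence the weight, and so carries the unique minimum of
  one direction to that of the other.\<close>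

lemma symmetric_lightest:
  assumes sym: "\<And>u v. ed u v = ed v u"
  shows "rpts_symmetric V E lightest"
  unfolding rpts_symmetric_def
proof (intro allI ballI impI)
  fix F s t
  have rev_path: "is_path ed V (E - F) b a (rev p)" if "is_path ed V (E - F) a b p" for a b p
    using that path_edges_rev[of ed p] sym by (auto simp: is_path_def hd_rev last_rev)
  show "lightest s t F = rev (lightest t s F)"
  proof (cases "\<exists>p. is_path ed V (E - F) t s p")
    case True
    then obtain p where "is_path ed V (E - F) t s p" ..
    then have p: "is_path ed V (E - F) t s (lightest t s F)"
      by (rule lightest_is_path)
    show ?thesis
    proof (rule lightest_eqI[OF rev_path[OF p]])
      fix q
      assume q: "is_path ed V (E - F) s t q"
      then show "path_weight ed w (rev (lightest t s F)) \<le> path_weight ed w q"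
        using lightest_le[OF rev_path[OF q]] p path_weight_rev[OF sym]
        by (simp add: is_path_def)
    qed
  next
    case False
    then show ?thesis
      using rev_path lightest_Nil by (metis rev.simps(1))
  qed
qed

text \<open>For each admissible fault set the chosen path lies in the overlay, avoids the faults and
  is already shortest in the whole graph.\<close>

lemma ft_preserver_lightest:
  assumes "S \<subseteq> V"
  shows "ft_preserver ed f V E S (overlay ed f V E S lightest)"
proof -
  let ?H = "overlay ed f V E S lightest"
  have sub: "?H \<subseteq> E"
    using lightest_edges by (fastforce simp: overlay_def)
  have "graph_dist ed V (?H - F) s t = graph_dist ed V (E - F) s t"
    if "s \<in> S" "t \<in> V" "F \<subseteq> E" "card F \<le> f" for s t F
  proof (rule antisym)
    show "graph_dist ed V (E - F) s t \<le> graph_dist ed V (?H - F) s t"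
    proof -
      have "is_path ed V (E - F) s t p" if "is_path ed V (?H - F) s t p" for p
        using that sub unfolding is_path_def by blast
      then show ?thesis
        unfolding graph_dist_def by (intro INF_superset_mono) auto
    qed
    show "graph_dist ed V (?H - F) s t \<le> graph_dist ed V (E - F) s t"
      unfolding graph_dist_def
    proof (intro INF_mono)
      fix q
      assume "q \<in> {p. is_path ed V (E - F) s t p}"
      then have q: "is_path ed V (E - F) s t q"
        by simp
      have "path_edges ed (lightest s t F) \<subseteq> ?H"
        using that by (auto simp: overlay_def)
      then have "is_path ed V (?H - F) s t (lightest s t F)"
        using lightest_is_path[OF q] by (auto simp: is_path_def)
      then show "\<exists>p\<in>{p. is_path ed V (?H - F) s t p}. enat (length p - 1) \<le> enat (length q - 1)"
        using lightest_length[OF q] by (auto intro: diff_le_mono)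
    qed
  qed
  then show ?thesis
    using sub by (simp add: ft_preserver_def)
qed

end

text \<open>The first two properties are what \<open>weighted_graph\<close> asks for. The third
  leaves the tiebreaking to an adversary: among equally many edges, one edge whose key tops all keys
  of the other set decides.\<close>

lemma tiebreaking_weights:
  fixes key :: "'e \<Rightarrow> nat"
  assumes "finite E"
  shows "\<exists>w :: 'e \<Rightarrow> nat. inj_on (sum w) (Pow E) \<and>
    (\<forall>A\<subseteq>E. \<forall>B\<subseteq>E. card A < card B \<longrightarrow> sum w A < sum w B) \<and>
    (\<forall>A\<subseteq>E. \<forall>B\<subseteq>E. \<forall>e\<in>B. card A = card B \<longrightarrow> (\<forall>a\<in>A. key a < key e) \<longrightarrow> sum w A < sum w B)"
proof -
  obtain idx :: "'e \<Rightarrow> nat" and m where idx: "idx ` E = {i. i < m}" "inj_on idx E"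
    using finite_imp_inj_to_nat_seg[OF assms] by blast
  have idx_less: "idx e < m" if "e \<in> E" for e
    using that idx by auto
  \<comment> \<open>Lexicographic order by \<open>key\<close>, then by index: as
    \<open>idx e < m\<close>, the index acts as a last digit in base \<open>m\<close>.\<close>
  define g where "g e = key e * m + idx e" for e
  have g_less: "g a < g e" if "key a < key e" "a \<in> E" for a e
  proof -
    have "g a < (key a + 1) * m"
      using idx_less[OF that(2)] by (simp add: g_def)
    also have "\<dots> \<le> key e * m"
      using that by (intro mult_right_mono) auto
    finally show ?thesis
      by (simp add: g_def)
  qed
  have g_inj: "inj_on g E"
  proof (rule inj_onI)
    fix a b
    assume ab: "a \<in> E" "b \<in> E" "g a = g b"
    then have "key a = key b"
      using g_less[of a b] g_less[of b a] by (metis less_irrefl linorder_neqE_nat)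
    then show "a = b"
      using ab idx by (auto simp: g_def dest: inj_onD)
  qed
  \<comment> \<open>\<open>M\<close> exceeds the sum of all perturbations, so one additional edge
    outweighs them, and \<open>card A\<close> and \<open>enc A\<close> are quotient and remainder of
    \<open>sum w A\<close> modulo \<open>M\<close>.\<close>
  define M :: nat where "M = Suc (\<Sum>e\<in>E. 2 ^ g e)"
  define w where "w e = M + 2 ^ g e" for e
  define enc :: "'e set \<Rightarrow> nat" where "enc A = (\<Sum>e\<in>A. 2 ^ g e)" for A
  have sum_w: "sum w A = card A * M + enc A" for A
    by (simp add: w_def enc_def sum.distrib)
  have enc_less: "enc A < M" if "A \<subseteq> E" for A
    unfolding enc_def M_def using that assms
    by (intro le_imp_less_Suc sum_mono2) auto
  have enc_set: "enc A = set_encode (g ` A)" if "A \<subseteq> E" for A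
    unfolding enc_def set_encode_def
    using sum.reindex[OF inj_on_subset[OF g_inj that], of "\<lambda>i. 2 ^ i :: nat"] by simp
  show ?thesis
  proof (intro exI[of _ w] conjI allI impI ballI)
    show "inj_on (sum w) (Pow E)"
    proof (rule inj_onI)
      fix A B
      assume AB: "A \<in> Pow E" "B \<in> Pow E" "sum w A = sum w B"
      then have "enc A = enc B"
        using enc_less[of A] enc_less[of B] unfolding sum_w
        by (metis PowD mod_less mod_mult_self3)
      then have "set_encode (g ` A) = set_encode (g ` B)"
        using AB enc_set by simp
      moreover have "finite (g ` A)" "finite (g ` B)"
        using AB assms by (meson PowD finite_imageI finite_subset)+
      ultimately have "g ` A = g ` B"
        by (metis set_encode_inverse)
      then show "A = B"
        using AB g_inj inj_on_image_eq_iff by blast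
    qed
  next
    fix A B
    assume AB: "A \<subseteq> E" "B \<subseteq> E" "card A < card B"
    have "sum w A < (card A + 1) * M"
      using enc_less[OF AB(1)] by (simp add: sum_w)
    also have "\<dots> \<le> card B * M"
      using AB by (intro mult_right_mono) auto
    finally show "sum w A < sum w B"
      by (simp add: sum_w)
  next
    fix A B e
    assume AB: "A \<subseteq> E" "B \<subseteq> E" "e \<in> B" "card A = card B" and
      key: "\<forall>a\<in>A. key a < key e"
    \<comment> \<open>Distinct powers of two with exponents below \<open>g e\<close> add up to less
      than the single power contributed by \<open>e\<close>.\<close>
    have "g ` A \<subseteq> {..<g e}"
      using AB key g_less by blast
    then have "(\<Sum>i\<in>g ` A. 2 ^ i) \<le> (\<Sum>i<g e. 2 ^ i :: nat)"
      by (intro sum_mono2) auto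
    also have "\<dots> = 2 ^ g e - 1"
      by (simp add: mask_eq_sum_exp_nat lessThan_def)
    also have "\<dots> < 2 ^ g e"
      by simp
    also have "\<dots> \<le> enc B"
      unfolding enc_def using AB assms finite_subset by (intro member_le_sum) auto
    finally have "enc A < enc B"
      using enc_set[OF AB(1)] by (simp add: set_encode_def)
    then show "sum w A < sum w B"
      using AB by (simp add: sum_w)
  qed
qed

section \<open>Cutting leaves of a trie\<close>

text \<open>These are the nodes of the trie with leaf set \<open>L\<close>; the root is
  \<open>[]\<close>.\<close>

definition prefixes_of :: "'a list set \<Rightarrow> 'a list set" where
  "prefixes_of L = {take i z | i z. z \<in> L}"

text \<open>
  Reading \<open>L\<close> as the leaf set of a trie, a set \<open>F\<close> of strings stands for the faulty tree edges
  entering these strings: a leaf survives iff no prefix of it lies in \<open>F\<close>.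
\<close>

definition cuttable :: "nat \<Rightarrow> 'a list set \<Rightarrow> ('a list \<Rightarrow> nat) \<Rightarrow> bool" where
  "cuttable f L rank \<longleftrightarrow> (\<forall>z\<in>L. \<exists>F. finite F \<and> card F \<le> f \<and> (\<forall>y\<in>F. \<not> prefix y z) \<and>
     (\<forall>y\<in>L. y = z \<or> rank y < rank z \<or> (\<exists>x\<in>F. prefix x y)))"

lemma finite_prefixes_of:
  assumes "finite L"
  shows "finite (prefixes_of L)"
proof -
  have "prefixes_of L \<subseteq> (\<Union>z\<in>L. (\<lambda>i. take i z) ` {..length z})"
  proof
    fix y
    assume "y \<in> prefixes_of L"
    then obtain i z where "z \<in> L" "y = take i z"
      by (auto simp: prefixes_of_def)
    then have "y = take (min i (length z)) z" "min i (length z) \<in> {..length z}"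
      by (auto simp: min_def)
    then show "y \<in> (\<Union>z\<in>L. (\<lambda>i. take i z) ` {..length z})"
      using \<open>z \<in> L\<close> by blast
  qed
  then show ?thesis
    using assms finite_subset by blast
qed

text \<open>Copies of the old trie hang off a spine of \<open>True\<close> letters, and leaves are
  ranked by copy first. One new fault on the spine removes all later copies, the old faults work
  inside the copy of the given leaf, and earlier copies have smaller rank.\<close>

lemma cuttable_block:
  fixes L :: "bool list set" and d :: nat
  defines "block \<equiv> \<lambda>i. replicate i True @ replicate (d - i) False"
  assumes "finite L" "cuttable f L rank"
  shows "\<exists>rank'. cuttable (Suc f) ((\<lambda>(i, z). block i @ z) ` ({..<d} \<times> L)) rank'"
proof -
  have len: "length (block i) = d" if "i < d" for i
    using that by (simp add: block_def)
  define M where "M = Suc (\<Sum>z\<in>L. rank z)"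
  have M: "rank z < M" if "z \<in> L" for z
    unfolding M_def using that assms(2) by (intro le_imp_less_Suc member_le_sum) auto
  \<comment> \<open>The number of \<open>True\<close> letters among the first \<open>d\<close> is
    the index of the copy; \<open>M\<close> bounds the old ranks, so the index dominates.\<close>
  define rank' where "rank' y = length (filter id (take d y)) * M + rank (drop d y)" for y
  have rank': "rank' (block i @ z) = i * M + rank z" if "i < d" for i z
    using len[OF that] by (simp add: rank'_def) (simp add: block_def)
  have "cuttable (Suc f) ((\<lambda>(i, z). block i @ z) ` ({..<d} \<times> L)) rank'"
    unfolding cuttable_def
  proof (rule ballI)
    fix zz
    assume "zz \<in> (\<lambda>(i, z). block i @ z) ` ({..<d} \<times> L)"
    then obtain i z where i: "i < d" and z: "z \<in> L" and zz: "zz = block i @ z"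
      by auto
    obtain F where F: "finite F" "card F \<le> f" "\<And>y. y \<in> F \<Longrightarrow> \<not> prefix y z"
      "\<And>y. y \<in> L \<Longrightarrow> y = z \<or> rank y < rank z \<or> (\<exists>x\<in>F. prefix x y)"
      using assms(3) z unfolding cuttable_def by metis
    \<comment> \<open>Blocks of index above \<open>i\<close> are exactly those starting with
      \<open>i + 1\<close> letters \<open>True\<close>. For \<open>i = d - 1\<close> there are none,
      and the new string is a prefix of no leaf.\<close>
    define F' where "F' = insert (replicate (Suc i) True) ((@) (block i) ` F)"
    have "finite F'"
      using F by (simp add: F'_def)
    moreover have "card F' \<le> Suc f"
    proof -
      have "card F' \<le> Suc (card ((@) (block i) ` F))"
        unfolding F'_def by (rule card_insert_le_m1) auto
      then show ?thesis
        using card_image_le[OF F(1), of "(@) (block i)"] F(2) by linarith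
    qed
    moreover have "\<not> prefix y zz" if "y \<in> F'" for y
    proof -
      have "\<not> prefix (replicate (Suc i) True) zz"
      proof
        assume "prefix (replicate (Suc i) True) zz"
        then have "zz ! i"
          by (auto simp: prefix_def nth_append simp del: replicate_Suc)
        then show False
          using i by (simp add: zz block_def nth_append)
      qed
      then show ?thesis
        using that F(3) by (auto simp: F'_def zz)
    qed
    moreover have "yy = zz \<or> rank' yy < rank' zz \<or> (\<exists>x\<in>F'. prefix x yy)"
      if yy_in: "yy \<in> (\<lambda>(i, z). block i @ z) ` ({..<d} \<times> L)" for yy
    proof -
      obtain k y where k: "k < d" and y: "y \<in> L" and yy: "yy = block k @ y"
        using yy_in by auto
      consider "k < i" | "k = i" | "i < k" by linarith
      then show ?thesis
      proof cases
        case 1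
        have "rank' yy < (k + 1) * M"
          using M[OF y] rank'[OF k, of y] by (simp add: yy)
        also have "\<dots> \<le> i * M"
          using 1 by (intro mult_right_mono) auto
        finally show ?thesis
          using rank'[OF i, of z] by (simp add: zz)
      next
        case 2
        then show ?thesis
          using F(4)[OF y] rank'[OF i] by (auto simp: F'_def zz yy)
      next
        case 3
        then have "replicate k True = replicate (Suc i) True @ replicate (k - Suc i) True"
          by (metis Suc_leI le_add_diff_inverse replicate_add)
        then have "prefix (replicate (Suc i) True) yy"
          by (simp add: yy block_def)
        then show ?thesis
          by (auto simp: F'_def)
      qed
    qed
    ultimately show "\<exists>F. finite F \<and> card F \<le> Suc f \<and> (\<forall>y\<in>F. \<not> prefix y zz) \<and>
        (\<forall>y\<in>(\<lambda>(i, z). block i @ z) ` ({..<d} \<times> L).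
           y = zz \<or> rank' y < rank' zz \<or> (\<exists>x\<in>F. prefix x y))"
      by (intro exI[of _ F'] conjI ballI)
  qed
  then show ?thesis by blast
qed

text \<open>With \<open>d = q ^ 2 ^ f\<close> copies, the blocks contribute at most
  \<open>d * (d + 1)\<close> nodes and the copies at most \<open>d * (2 * f + 1) * d\<close>. Both
  are of order \<open>d * d = q ^ 2 ^ Suc f\<close>, while the number of leaves is multiplied by
  \<open>d\<close>.\<close>

lemma ex_cuttable:
  assumes "q \<ge> 1"
  shows "\<exists>(L :: bool list set) h rank. finite L \<and> (\<forall>z\<in>L. length z = h) \<and> cuttable f L rank \<and>
    card L = q ^ (2 ^ f - 1) \<and> card (prefixes_of L) \<le> (2 * f + 1) * q ^ 2 ^ f"
proof (induction f)
  case 0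
  have "prefixes_of {[]} = {[] :: bool list}"
    by (auto simp: prefixes_of_def)
  moreover have "cuttable 0 {[] :: bool list} (\<lambda>_. 0)"
    unfolding cuttable_def by (intro ballI exI[of _ "{}"]) auto
  ultimately show ?case
    using assms
    by (intro exI[of _ "{[]}"] exI[of _ 0] exI[of _ "\<lambda>_. 0"]) simp
next
  case (Suc f)
  then obtain L :: "bool list set" and h rank where L: "finite L" "\<And>z. z \<in> L \<Longrightarrow> length z = h"
    "cuttable f L rank" "card L = q ^ (2 ^ f - 1)"
    "card (prefixes_of L) \<le> (2 * f + 1) * q ^ 2 ^ f"
    by blast
  define d where "d = q ^ 2 ^ f"
  have d: "d \<ge> 1"
    using assms by (simp add: d_def)
  define block where "block i = replicate i True @ replicate (d - i) False" for i
  define L' where "L' = (\<lambda>(i, z). block i @ z) ` ({..<d} \<times> L)"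
  obtain rank' where "cuttable (Suc f) L' rank'"
    using cuttable_block[OF L(1,3), of d] unfolding L'_def block_def by blast
  moreover have len: "length (block i) = d" if "i < d" for i
    using that by (simp add: block_def)
  have "inj_on (\<lambda>(i, z). block i @ z) ({..<d} \<times> L)"
  proof (rule inj_onI, clarsimp)
    fix i z k y
    assume *: "i < d" "k < d" "block i @ z = block k @ y"
    then have eq: "block i = block k" "z = y"
      using len append_eq_append_conv by metis+
    have "length (filter id (block j)) = j" for j
      by (simp add: block_def)
    then show "i = k \<and> z = y"
      using eq by metis
  qed
  then have "card L' = d * card L"
    by (simp add: L'_def card_image card_cartesian_product)
  then have "card L' = q ^ (2 ^ Suc f - 1)"
  proof -
    have "(2::nat) ^ Suc f - 1 = 2 ^ f + (2 ^ f - 1)"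
      by simp
    then show ?thesis
      using \<open>card L' = d * card L\<close> L(4) by (simp only: d_def power_add)
  qed
  moreover have "card (prefixes_of L') \<le> (2 * Suc f + 1) * q ^ 2 ^ Suc f"
  proof -
    \<comment> \<open>\<open>?P\<close> holds the nodes inside or at the end of a block,
      \<open>?Q\<close> those in the copies of the old trie.\<close>
    let ?P = "(\<lambda>(i, k). take k (block i)) ` ({..<d} \<times> {..d})"
    let ?Q = "(\<lambda>(i, y). block i @ y) ` ({..<d} \<times> prefixes_of L)"
    have "prefixes_of L' \<subseteq> ?P \<union> ?Q"
    proof
      fix x
      assume "x \<in> prefixes_of L'"
      then obtain k i z where x: "x = take k (block i @ z)" "i < d" "z \<in> L"
        by (auto simp: prefixes_of_def L'_def)
      show "x \<in> ?P \<union> ?Q"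
      proof (cases "k \<le> d")
        case True
        then have "x = take k (block i)"
          using x len by simp
        then show ?thesis
          using x(2) True by (intro UnI1 image_eqI[of _ _ "(i, k)"]) auto
      next
        case False
        then have "x = block i @ take (k - d) z"
          using x len by simp
        moreover have "take (k - d) z \<in> prefixes_of L"
          using x(3) by (auto simp: prefixes_of_def)
        ultimately show ?thesis
          using x(2) by (intro UnI2 image_eqI[of _ _ "(i, take (k - d) z)"]) auto
      qed
    qed
    then have "card (prefixes_of L') \<le> card (?P \<union> ?Q)"
      using finite_prefixes_of[OF L(1)] by (intro card_mono) auto
    also have "\<dots> \<le> card ?P + card ?Q"
      by (rule card_Un_le)
    also have "card ?P \<le> d * Suc d"
      using card_image_le[of "{..<d} \<times> {..d}" "\<lambda>(i, k). take k (block i)"]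
      by (simp add: card_cartesian_product)
    also have "card ?Q \<le> d * card (prefixes_of L)"
      using card_image_le[of "{..<d} \<times> prefixes_of L" "\<lambda>(i, y). block i @ y"]
        finite_prefixes_of[OF L(1)]
      by (simp add: card_cartesian_product)
    also have "d * card (prefixes_of L) \<le> d * ((2 * f + 1) * d)"
      using L(5) by (simp add: d_def)
    also have "d * Suc d + d * ((2 * f + 1) * d) \<le> (2 * Suc f + 1) * (d * d)"
      using d by (simp add: algebra_simps)
    also have "d * d = q ^ 2 ^ Suc f"
      by (simp add: d_def power_add[symmetric] mult_2[symmetric])
    finally show ?thesis by simp
  qed
  moreover have "finite L'" "\<forall>z\<in>L'. length z = d + h"
    using L len by (auto simp: L'_def)
  ultimately show ?case by blast
qed

section \<open>Tries joined to a common vertex set\<close>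

text \<open>Vertex \<open>code (j, y)\<close> is node \<open>y\<close> in copy \<open>j\<close> of
  the trie. The codes fill the numbers below \<open>k * card (prefixes_of L)\<close>; the remaining
  numbers below \<open>n\<close> form the common set \<open>X\<close>.\<close>

locale trie_graph =
  fixes ed :: "nat \<Rightarrow> nat \<Rightarrow> 'e" and L :: "bool list set" and rank :: "bool list \<Rightarrow> nat"
    and code :: "nat \<times> bool list \<Rightarrow> nat" and f h k n :: nat
  assumes ed_eq: "\<And>u v u' v'. ed u v = ed u' v' \<Longrightarrow> u = u' \<and> v = v' \<or> u = v' \<and> v = u'"
    and finite_L: "finite L" and L_nonempty: "L \<noteq> {}"
    and length_L: "\<And>z. z \<in> L \<Longrightarrow> length z = h"
    and cut: "cuttable f L rank"
    and code_bij: "bij_betw code ({..<k} \<times> prefixes_of L) {..<k * card (prefixes_of L)}"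
    and fits: "k * card (prefixes_of L) \<le> n"
begin

abbreviation "slots \<equiv> {..<k} \<times> prefixes_of L"
abbreviation "K \<equiv> k * card (prefixes_of L)"

definition tree_arcs :: "(nat \<times> nat) set" where
  "tree_arcs = {(code (j, butlast y), code (j, y)) | j y. j < k \<and> y \<in> prefixes_of L \<and> y \<noteq> []}"

definition leaf_arcs :: "(nat \<times> nat) set" where
  "leaf_arcs = {(code (j, z), x) | j z x. j < k \<and> z \<in> L \<and> x \<in> {K..<n}}"

definition arcs :: "(nat \<times> nat) set" where
  "arcs = tree_arcs \<union> leaf_arcs"

definition edges :: "'e set" where
  "edges = case_prod ed ` arcs"

text \<open>The depth below the root, with the vertices of \<open>X\<close> placed one step below
  the leaves.\<close>

definition level :: "nat \<Rightarrow> nat" where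
  "level v = (if v < K then length (snd (inv_into slots code v)) else Suc h)"

text \<open>Tree arcs get 0 and arcs into \<open>X\<close> a positive key that falls as the rank of
  the leaf grows. The total of all ranks bounds each rank, so the subtraction never truncates on
  leaves.\<close>

definition arc_key :: "nat \<times> nat \<Rightarrow> nat" where
  "arc_key = (\<lambda>(u, v). if v < K then 0
     else Suc ((\<Sum>z\<in>L. rank z) - rank (snd (inv_into slots code u))))"

definition key :: "'e \<Rightarrow> nat" where
  "key e = arc_key (inv_into arcs (case_prod ed) e)"

definition leaf_path :: "nat \<Rightarrow> bool list \<Rightarrow> nat \<Rightarrow> nat list" where
  "leaf_path j z x = map (\<lambda>i. code (j, take i z)) [0..<Suc h] @ [x]"

lemma take_in_prefixes: "y \<in> prefixes_of L \<Longrightarrow> take i y \<in> prefixes_of L"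
  by (clarsimp simp: prefixes_of_def) blast

lemma leaf_in_prefixes: "z \<in> L \<Longrightarrow> z \<in> prefixes_of L"
  unfolding prefixes_of_def by (intro CollectI exI[of _ "length z"] exI[of _ z]) simp

lemma Nil_in_prefixes: "[] \<in> prefixes_of L"
  using L_nonempty take_in_prefixes[of _ 0] leaf_in_prefixes by fastforce

lemma code_less: "j < k \<Longrightarrow> y \<in> prefixes_of L \<Longrightarrow> code (j, y) < K"
  using bij_betwE[OF code_bij] by blast

lemma inv_code: "j < k \<Longrightarrow> y \<in> prefixes_of L \<Longrightarrow> inv_into slots code (code (j, y)) = (j, y)"
  using code_bij by (intro inv_into_f_f) (auto simp: bij_betw_def)

lemma code_eqD:
  "code (i, x) = code (j, y) \<Longrightarrow> i < k \<Longrightarrow> j < k \<Longrightarrow> x \<in> prefixes_of L \<Longrightarrow> y \<in> prefixes_of L \<Longrightarrow>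
   i = j \<and> x = y"
  using inv_code by (metis Pair_inject)

lemma level_code: "j < k \<Longrightarrow> y \<in> prefixes_of L \<Longrightarrow> level (code (j, y)) = length y"
  by (simp add: level_def code_less inv_code)

lemma butlast_in_prefixes: "y \<in> prefixes_of L \<Longrightarrow> butlast y \<in> prefixes_of L"
  by (simp add: butlast_conv_take take_in_prefixes)

text \<open>This grading replaces an orientation in the undirected case: it excludes loops and
  opposite arcs and limits how fast a path can descend.\<close>

lemma level_arc:
  assumes "(u, v) \<in> arcs"
  shows "level v = Suc (level u)"
proof -
  consider j y where "j < k" "y \<in> prefixes_of L" "y \<noteq> []" "u = code (j, butlast y)" "v = code (j, y)"
    | j z where "j < k" "z \<in> L" "u = code (j, z)" "K \<le> v"
    using assms by (auto simp: arcs_def tree_arcs_def leaf_arcs_def)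
  then show ?thesis
  proof cases
    case 1
    then show ?thesis
      by (simp add: level_code butlast_in_prefixes)
  next
    case 2
    then show ?thesis
      by (simp add: level_code leaf_in_prefixes length_L) (simp add: level_def)
  qed
qed

lemma arcs_subset: "arcs \<subseteq> {..<n} \<times> {..<n}"
proof -
  have "code (j, y) < n" if "j < k" "y \<in> prefixes_of L" for j y
    using code_less[OF that] fits by simp
  then show ?thesis
    using butlast_in_prefixes leaf_in_prefixes
    by (fastforce simp: arcs_def tree_arcs_def leaf_arcs_def)
qed

lemma finite_edges: "finite edges"
  unfolding edges_def using finite_subset[OF arcs_subset] by simp

text \<open>Two arcs could share an undirected edge only by being opposite, but each arc raises the
  level. Hence keys of arcs carry over to edges.\<close>

lemma inj_ed: "inj_on (case_prod ed) arcs"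
proof (rule inj_onI, clarify)
  fix u v u' v'
  assume *: "(u, v) \<in> arcs" "(u', v') \<in> arcs" "ed u v = ed u' v'"
  then show "u = u' \<and> v = v'"
    using ed_eq[OF *(3)] level_arc[OF *(1)] level_arc[OF *(2)] by auto
qed

lemma ed_arc_eqD: "ed u v = ed u' v' \<Longrightarrow> (u, v) \<in> arcs \<Longrightarrow> (u', v') \<in> arcs \<Longrightarrow> u = u' \<and> v = v'"
  using inj_onD[OF inj_ed, of "(u, v)" "(u', v')"] by simp

lemma key_ed: "(u, v) \<in> arcs \<Longrightarrow> key (ed u v) = arc_key (u, v)"
  using inv_into_f_f[OF inj_ed, of "(u, v)"] by (simp add: key_def)

lemma ed_in_edgesD: "ed u v \<in> edges \<Longrightarrow> (u, v) \<in> arcs \<or> (v, u) \<in> arcs"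
  unfolding edges_def using ed_eq by fastforce

lemma path_step:
  assumes "path_edges ed p \<subseteq> edges" "Suc i < length p"
  shows "(p ! i, p ! Suc i) \<in> arcs \<or> (p ! Suc i, p ! i) \<in> arcs"
  using assms by (intro ed_in_edgesD) (auto simp: path_edges_def)

lemma level_path:
  assumes "path_edges ed p \<subseteq> edges" "i + d < length p"
  shows "level (p ! (i + d)) \<le> level (p ! i) + d"
  using assms(2)
proof (induction d)
  case (Suc d)
  then have "level (p ! Suc (i + d)) \<le> Suc (level (p ! (i + d)))"
    using path_step[OF assms(1), of "i + d"] by (auto dest: level_arc)
  then show ?case
    using Suc by simp
qed simp

lemma leaf_arc: "j < k \<Longrightarrow> z \<in> L \<Longrightarrow> x \<in> {K..<n} \<Longrightarrow> (code (j, z), x) \<in> arcs"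
  by (auto simp: arcs_def leaf_arcs_def)

lemma tree_arc: "j < k \<Longrightarrow> y \<in> prefixes_of L \<Longrightarrow> y \<noteq> [] \<Longrightarrow> (code (j, butlast y), code (j, y)) \<in> arcs"
  by (auto simp: arcs_def tree_arcs_def)

lemma take_arc:
  assumes "j < k" "z \<in> L" "i < h"
  shows "(code (j, take i z), code (j, take (Suc i) z)) \<in> arcs"
proof -
  have "butlast (take (Suc i) z) = take i z" "take (Suc i) z \<noteq> []"
    using assms length_L[of z] by (auto simp: butlast_take)
  then show ?thesis
    using tree_arc[of j "take (Suc i) z"] assms take_in_prefixes leaf_in_prefixes by simp
qed

lemma path_edges_leaf_path:
  assumes "z \<in> L"
  shows "path_edges ed (leaf_path j z x)
    = insert (ed (code (j, z)) x) ((\<lambda>i. ed (code (j, take i z)) (code (j, take (Suc i) z))) ` {..<h})"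
proof -
  let ?p = "map (\<lambda>i. code (j, take i z)) [0..<Suc h]"
  have p: "?p = map (\<lambda>i. code (j, take i z)) [0..<h] @ [code (j, z)]"
    using length_L[OF assms] by simp
  have nth: "?p ! i = code (j, take i z)" if "i < Suc h" for i
    using that by (metis add_0 diff_zero length_upt nth_map nth_upt)
  have "path_edges ed ?p = (\<lambda>i. ed (?p ! i) (?p ! Suc i)) ` {..<h}"
    unfolding path_edges_def by auto
  also have "\<dots> = (\<lambda>i. ed (code (j, take i z)) (code (j, take (Suc i) z))) ` {..<h}"
    using nth by (intro image_cong refl) (simp del: upt_Suc)
  finally show ?thesis
    using path_edges_append[of ed "map (\<lambda>i. code (j, take i z)) [0..<h]" "code (j, z)" "[x]"] p
    by (simp add: leaf_path_def)
qed

lemma is_path_leaf_path: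
  assumes "j < k" "z \<in> L" "x \<in> {K..<n}" "path_edges ed (leaf_path j z x) \<inter> F = {}"
  shows "is_path ed {..<n} (edges - F) (code (j, [])) x (leaf_path j z x)"
proof -
  have less: "code (j, take i z) < K" for i
    using assms code_less take_in_prefixes leaf_in_prefixes by blast
  have "distinct (map (\<lambda>i. code (j, take i z)) [0..<Suc h])"
    unfolding distinct_map
  proof (intro conjI inj_onI)
    fix a b
    assume "a \<in> set [0..<Suc h]" "b \<in> set [0..<Suc h]" "code (j, take a z) = code (j, take b z)"
    moreover from this(3) have "take a z = take b z"
      using code_eqD assms take_in_prefixes leaf_in_prefixes by blast
    then have "min (length z) a = min (length z) b"
      by (metis length_take min.commute)
    ultimately show "a = b"
      using length_L[OF assms(2)] by auto
  qed simp
  moreover have "x \<noteq> code (j, take i z)" for i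
    using less[of i] assms(3) by auto
  ultimately have "distinct (leaf_path j z x)"
    by (auto simp: leaf_path_def simp del: upt_Suc)
  moreover have "set (leaf_path j z x) \<subseteq> {..<n}"
    using less_le_trans[OF less fits] assms(3) by (auto simp: leaf_path_def)
  moreover have "path_edges ed (leaf_path j z x) \<subseteq> edges"
    unfolding path_edges_leaf_path[OF assms(2)] edges_def
    using take_arc[OF assms(1,2)] leaf_arc[OF assms(1-3)] by force
  moreover have "hd (leaf_path j z x) = code (j, [])"
    by (simp add: leaf_path_def upt_conv_Cons del: upt_Suc)
  ultimately show ?thesis
    using assms(4) by (auto simp: is_path_def leaf_path_def)
qed

text \<open>A step raises the level by at most one, so a path of minimum possible length from the root
  to level \<open>h + 1\<close> never goes backwards; and going forwards, each vertex determines
  its predecessors up to the root.\<close>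

lemma root_path_cases:
  assumes p: "is_path ed {..<n} (edges - F) (code (j, [])) x p"
    and "j < k" "x \<in> {K..<n}" "length p \<le> Suc (Suc h)"
  obtains z where "z \<in> L" "p = leaf_path j z x"
proof -
  have pe: "path_edges ed p \<subseteq> edges" and ne: "p \<noteq> []"
    and hd: "p ! 0 = code (j, [])" and last: "p ! (length p - 1) = x"
    using p by (auto simp: is_path_def hd_conv_nth last_conv_nth)
  have lev0: "level (p ! 0) = 0"
    using hd assms(2) level_code Nil_in_prefixes by simp
  have levx: "level x = Suc h"
    using assms(3) by (simp add: level_def)
  have len: "length p = Suc (Suc h)"
    using level_path[OF pe, of 0 "length p - 1"] ne lev0 levx last assms(4) by simp
  \<comment> \<open>Squeezed from both ends: \<open>i\<close> steps from the root reach level at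
    most \<open>i\<close>, and the \<open>h + 1 - i\<close> remaining steps must still reach level
    \<open>h + 1\<close>.\<close>
  have lev: "level (p ! i) = i" if "i \<le> Suc h" for i
  proof (rule antisym)
    show "level (p ! i) \<le> i"
      using level_path[OF pe, of 0 i] that len lev0 by simp
    show "i \<le> level (p ! i)"
      using level_path[OF pe, of i "Suc h - i"] that len last levx by simp
  qed
  have arc: "(p ! i, p ! Suc i) \<in> arcs" if "i \<le> h" for i
    using path_step[OF pe, of i] that len lev[of i] lev[of "Suc i"] level_arc[of "p ! Suc i" "p ! i"]
    by auto
  have "(p ! h, x) \<in> arcs"
    using arc[of h] last len by simp
  moreover have "(p ! h, x) \<notin> tree_arcs"
    using assms(3) code_less by (fastforce simp: tree_arcs_def)
  ultimately obtain j' z where z: "j' < k" "z \<in> L" "p ! h = code (j', z)"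
    by (auto simp: arcs_def leaf_arcs_def)
  \<comment> \<open>The induction runs upwards from the leaf, since a node has one parent but
    possibly several children.\<close>
  have nth: "p ! (h - d) = code (j', take (h - d) z)" if "d \<le> h" for d
    using that
  proof (induction d)
    case 0
    then show ?case
      using z length_L by simp
  next
    case (Suc d)
    define i where "i = h - Suc d"
    have i: "h - d = Suc i" "i < h"
      using Suc.prems by (auto simp: i_def)
    have IH: "p ! Suc i = code (j', take (Suc i) z)"
      using Suc i by simp
    have pre: "take (Suc i) z \<in> prefixes_of L"
      using z take_in_prefixes leaf_in_prefixes by blast
    then have "(p ! i, p ! Suc i) \<notin> leaf_arcs"
      using IH code_less[OF z(1)] by (fastforce simp: leaf_arcs_def)
    then obtain j0 y where y: "j0 < k" "y \<in> prefixes_of L" "p ! i = code (j0, butlast y)"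
      "p ! Suc i = code (j0, y)"
      using arc[of i] i by (auto simp: arcs_def tree_arcs_def)
    then have "j0 = j'" "y = take (Suc i) z"
      using code_eqD IH z(1) pre by metis+
    moreover have "butlast (take (Suc i) z) = take i z"
      using i length_L[OF z(2)] by (simp add: butlast_take)
    ultimately show ?case
      using y by (simp add: i_def)
  qed
  \<comment> \<open>At \<open>d = h\<close> the prefix is the root, so the start of \<open>p\<close>
    fixes the copy.\<close>
  have "j' = j"
    using nth[of h] hd code_eqD[of j' "[]" j "[]"] z(1) assms(2) Nil_in_prefixes by simp
  have "p = leaf_path j z x"
  proof (rule nth_equalityI)
    show "length p = length (leaf_path j z x)"
      by (simp add: len leaf_path_def)
    fix i
    assume "i < length p"
    then consider "i \<le> h" | "i = Suc h"
      using len by linarith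
    then show "p ! i = leaf_path j z x ! i"
    proof cases
      case 1
      then show ?thesis
        using nth[of "h - i"] \<open>j' = j\<close> by (simp add: leaf_path_def nth_append del: upt_Suc)
    next
      case 2
      then show ?thesis
        using last len by (simp add: leaf_path_def nth_append del: upt_Suc)
    qed
  qed
  then show thesis
    using that z(2) by blast
qed

text \<open>The path through \<open>z\<close> survives the cut, so the chosen path is no longer and
  descends through some leaf. Another surviving leaf has smaller rank, hence a final edge of larger
  key, which makes its path heavier.\<close>

lemma leaf_edge_used:
  assumes "weighted_graph ed {..<n} edges w"
    and w: "\<forall>A\<subseteq>edges. \<forall>B\<subseteq>edges. \<forall>e\<in>B.
           card A = card B \<longrightarrow> (\<forall>a\<in>A. key a < key e) \<longrightarrow> sum w A < sum w B"
    and j: "j < k" and z: "z \<in> L" and x: "x \<in> {K..<n}"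
  shows "\<exists>F\<subseteq>edges. card F \<le> f \<and> ed (code (j, z)) x
    \<in> path_edges ed (weighted_graph.lightest ed {..<n} edges w (code (j, [])) x F)"
proof -
  interpret weighted_graph ed "{..<n}" edges w
    by fact
  obtain Y where Y: "finite Y" "card Y \<le> f" "\<And>y. y \<in> Y \<Longrightarrow> \<not> prefix y z"
    "\<And>y. y \<in> L \<Longrightarrow> y = z \<or> rank y < rank z \<or> (\<exists>x\<in>Y. prefix x y)"
    using cut z unfolding cuttable_def by metis
  \<comment> \<open>Only non-root nodes have an entering tree edge. Every string of \<open>Y\<close>
    that cuts a leaf is kept: it is a node, and it is not \<open>[]\<close>, which is a prefix of
    \<open>z\<close>.\<close>
  define Y' where "Y' = Y \<inter> prefixes_of L - {[]}"
  define F where "F = (\<lambda>y. ed (code (j, butlast y)) (code (j, y))) ` Y'"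
  have "F \<subseteq> edges"
    using tree_arc[OF j] by (force simp: F_def Y'_def edges_def)
  have "card F \<le> card Y'"
    unfolding F_def using Y by (intro card_image_le) (simp add: Y'_def)
  also have "\<dots> \<le> card Y"
    using Y by (intro card_mono) (auto simp: Y'_def)
  finally have "card F \<le> f"
    using Y by simp
  let ?p = "lightest (code (j, [])) x F"
  have take_pre: "take i y \<in> prefixes_of L" if "y \<in> L" for i y
    using that take_in_prefixes leaf_in_prefixes by blast
  have disj: "path_edges ed (leaf_path j z x) \<inter> F = {}"
  proof (rule ccontr)
    assume "\<not> ?thesis"
    then obtain e where e: "e \<in> path_edges ed (leaf_path j z x)" "e \<in> F"
      by blast
    then obtain y where y: "y \<in> Y'" "e = ed (code (j, butlast y)) (code (j, y))"
      by (auto simp: F_def)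
    then have y_arc: "(code (j, butlast y), code (j, y)) \<in> arcs" and y_pre: "y \<in> prefixes_of L"
      using tree_arc[OF j] by (auto simp: Y'_def)
    from e(1) consider "e = ed (code (j, z)) x"
      | i where "i < h" "e = ed (code (j, take i z)) (code (j, take (Suc i) z))"
      unfolding path_edges_leaf_path[OF z] by blast
    then show False
    proof cases
      case 1
      then have "ed (code (j, z)) x = ed (code (j, butlast y)) (code (j, y))"
        using y(2) by (rule trans[OF sym])
      then have "x = code (j, y)"
        using ed_arc_eqD[OF _ leaf_arc[OF j z x] y_arc] by blast
      then show False
        using x code_less[OF j y_pre] by simp
    next
      case (2 i)
      then have "ed (code (j, take i z)) (code (j, take (Suc i) z))
          = ed (code (j, butlast y)) (code (j, y))"
        using y(2) by simp
      then have "code (j, take (Suc i) z) = code (j, y)"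
        using ed_arc_eqD[OF _ take_arc[OF j z 2(1)] y_arc] by blast
      then have "take (Suc i) z = y"
        using code_eqD j take_pre[OF z] y_pre by blast
      then have "prefix y z"
        using take_is_prefix by blast
      then show False
        using y Y(3) by (auto simp: Y'_def)
    qed
  qed
  have q: "is_path ed {..<n} (edges - F) (code (j, [])) x (leaf_path j z x)"
    by (rule is_path_leaf_path[OF j z x disj])
  have p: "is_path ed {..<n} (edges - F) (code (j, [])) x ?p"
    by (rule lightest_is_path[OF q])
  moreover have "length ?p \<le> Suc (Suc h)"
    using lightest_length[OF q] by (simp add: leaf_path_def)
  ultimately obtain z' where z': "z' \<in> L" "?p = leaf_path j z' x"
    using root_path_cases j x by blast
  have "z' = z"
  proof (rule ccontr)
    assume "z' \<noteq> z"
    then consider "rank z' < rank z" | y where "y \<in> Y" "prefix y z'"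
      using Y(4)[OF z'(1)] by blast
    then show False
    proof cases
      case 1
      have le: "rank y \<le> (\<Sum>z\<in>L. rank z)" if "y \<in> L" for y
        using that finite_L by (intro member_le_sum) auto
      have key_leaf: "key (ed (code (j, y)) x) = Suc ((\<Sum>z\<in>L. rank z) - rank y)" if "y \<in> L" for y
        using key_ed[OF leaf_arc[OF j that x]] inv_code[OF j leaf_in_prefixes[OF that]] x
        by (simp add: arc_key_def)
      \<comment> \<open>Both paths have \<open>h + 1\<close> edges, so the key of the last edge
        through \<open>z'\<close> decides: it beats the tree edges, of key 0, and the last edge
        through \<open>z\<close>.\<close>
      have "sum w (path_edges ed (leaf_path j z x)) < sum w (path_edges ed ?p)"
      proof (rule w[rule_format])
        show "path_edges ed (leaf_path j z x) \<subseteq> edges" "path_edges ed ?p \<subseteq> edges"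
          using p q by (auto simp: is_path_def)
        have "distinct (leaf_path j z x)" "distinct ?p"
          using p q by (auto simp: is_path_def)
        then show "card (path_edges ed (leaf_path j z x)) = card (path_edges ed ?p)"
          by (simp add: card_path_edges z'(2)) (simp add: leaf_path_def)
        show "ed (code (j, z')) x \<in> path_edges ed ?p"
          using path_edges_leaf_path[OF z'(1)] z'(2) by simp
        fix a
        assume "a \<in> path_edges ed (leaf_path j z x)"
        then consider "a = ed (code (j, z)) x"
          | i where "i < h" "a = ed (code (j, take i z)) (code (j, take (Suc i) z))"
          unfolding path_edges_leaf_path[OF z] by blast
        then show "key a < key (ed (code (j, z')) x)"
        proof cases
          case 1
          then show ?thesis
            using key_leaf[OF z] key_leaf[OF z'(1)] le[OF z] \<open>rank z' < rank z\<close> by simp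
        next
          case (2 i)
          then have "key a = 0"
            using key_ed[OF take_arc[OF j z]] code_less[OF j take_pre[OF z]] by (simp add: arc_key_def)
          then show ?thesis
            using key_leaf[OF z'(1)] by simp
        qed
      qed
      moreover have "sum w (path_edges ed ?p) \<le> sum w (path_edges ed (leaf_path j z x))"
        using lightest_le[OF q] p q by (simp add: path_weight_eq_sum is_path_def)
      ultimately show False by simp
    next
      case (2 y)
      \<comment> \<open>Here a fault enters a prefix of \<open>z'\<close>, so the chosen path would
        traverse a faulty edge.\<close>
      have "y \<noteq> []"
        using 2(1) Y(3)[of y] by auto
      moreover have y: "y = take (length y) z'" "length y \<le> h"
        using 2 length_L[OF z'(1)] by (auto simp: prefix_def)
      ultimately have "y \<in> Y'"
        using 2 take_pre[OF z'(1)] by (metis DiffI IntI Y'_def singletonD)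
      then have "ed (code (j, butlast y)) (code (j, y)) \<in> F"
        by (simp add: F_def)
      moreover obtain i where i: "length y = Suc i"
        using \<open>y \<noteq> []\<close> by (cases y) auto
      have "butlast y = take i z'"
        using y(1) i y(2) length_L[OF z'(1)] by (metis Suc_le_lessD butlast_take diff_Suc_1 y(2))
      then have "ed (code (j, butlast y)) (code (j, y)) \<in> path_edges ed ?p"
        unfolding z'(2) path_edges_leaf_path[OF z'(1)]
        using i y by (intro insertI2 image_eqI[of _ _ i]) auto
      ultimately show False
        using p by (auto simp: is_path_def)
    qed
  qed
  then have "ed (code (j, z)) x \<in> path_edges ed ?p"
    using path_edges_leaf_path[OF z] z'(2) by simp
  then show ?thesis
    using \<open>F \<subseteq> edges\<close> \<open>card F \<le> f\<close> by blast
qed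

text \<open>The sources are the roots of the copies, padded by arbitrary vertices to size
  \<open>\<sigma>\<close>; the edges counted are all those between leaves and
  \<open>X\<close>.\<close>

lemma dense_overlay:
  assumes "k \<le> \<sigma>" "\<sigma> \<le> n"
  shows "\<exists>S \<pi>. S \<subseteq> {..<n} \<and> card S = \<sigma> \<and>
    rpts ed {..<n} edges \<pi> \<and> rpts_consistent {..<n} edges \<pi> \<and> rpts_stable ed {..<n} edges \<pi> \<and>
    ((\<forall>u v. ed u v = ed v u) \<longrightarrow> rpts_symmetric {..<n} edges \<pi>) \<and>
    ft_preserver ed f {..<n} edges S (overlay ed f {..<n} edges S \<pi>) \<and>
    k * card L * (n - K) \<le> card (overlay ed f {..<n} edges S \<pi>)"
proof -
  obtain w :: "'e \<Rightarrow> nat" where "inj_on (sum w) (Pow edges) \<and>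
    (\<forall>A\<subseteq>edges. \<forall>B\<subseteq>edges. card A < card B \<longrightarrow> sum w A < sum w B) \<and>
    (\<forall>A\<subseteq>edges. \<forall>B\<subseteq>edges. \<forall>e\<in>B. card A = card B \<longrightarrow> (\<forall>a\<in>A. key a < key e) \<longrightarrow> sum w A < sum w B)"
    using tiebreaking_weights[OF finite_edges, of key] ..
  note w = this[THEN conjunct1] this[THEN conjunct2, THEN conjunct1, rule_format]
    this[THEN conjunct2, THEN conjunct2]
  have wg: "weighted_graph ed {..<n} edges w"
    by (rule weighted_graph.intro) (fact finite_lessThan finite_edges ed_eq w(1) w(2))+
  then interpret weighted_graph ed "{..<n}" edges w .
  define R where "R = (\<lambda>j. code (j, [])) ` {..<k}"
  have "R \<subseteq> {..<n}"
    unfolding R_def using less_le_trans[OF code_less[OF _ Nil_in_prefixes] fits] by blast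
  moreover have "card R \<le> \<sigma>"
    using card_image_le[of "{..<k}" "\<lambda>j. code (j, [])"] assms by (simp add: R_def)
  ultimately obtain S where S: "R \<subseteq> S" "S \<subseteq> {..<n}" "card S = \<sigma>"
    using exists_subset_between[of R \<sigma> "{..<n}"] assms by auto
  let ?H = "overlay ed f {..<n} edges S lightest"
  have pres: "ft_preserver ed f {..<n} edges S ?H"
    by (rule ft_preserver_lightest[OF S(2)])
  define T where "T = (\<lambda>((j, z), x). (code (j, z), x)) ` (({..<k} \<times> L) \<times> {K..<n})"
  have T_arcs: "T \<subseteq> arcs"
    using leaf_arc by (auto simp: T_def)
  have "case_prod ed ` T \<subseteq> ?H"
  proof
    fix e
    assume "e \<in> case_prod ed ` T"
    then obtain j z x where jzx: "j < k" "z \<in> L" "x \<in> {K..<n}" "e = ed (code (j, z)) x"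
      by (auto simp: T_def)
    then obtain F where "F \<subseteq> edges" "card F \<le> f" "e \<in> path_edges ed (lightest (code (j, [])) x F)"
      using leaf_edge_used[OF wg w(3) jzx(1-3)] by blast
    moreover have "code (j, []) \<in> S"
      using S(1) jzx(1) by (auto simp: R_def)
    moreover have "x \<in> {..<n}"
      using jzx(3) by simp
    ultimately show "e \<in> ?H"
      unfolding overlay_def by blast
  qed
  moreover have "finite ?H"
    using pres finite_subset[OF _ finite_edges] by (simp add: ft_preserver_def)
  ultimately have "card (case_prod ed ` T) \<le> card ?H"
    by (simp add: card_mono)
  moreover have "card (case_prod ed ` T) = card T"
    by (intro card_image inj_on_subset[OF inj_ed T_arcs])
  moreover have "card T = k * card L * (n - K)"
  proof -
    have "inj_on (\<lambda>((j, z), x). (code (j, z), x)) (({..<k} \<times> L) \<times> {K..<n})"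
    proof (rule inj_onI)
      fix a b
      assume *: "a \<in> ({..<k} \<times> L) \<times> {K..<n}" "b \<in> ({..<k} \<times> L) \<times> {K..<n}"
        "(\<lambda>((j, z), x). (code (j, z), x)) a = (\<lambda>((j, z), x). (code (j, z), x)) b"
      obtain j z x j' z' x' where ab: "a = ((j, z), x)" "b = ((j', z'), x')"
        by (metis surj_pair)
      show "a = b"
        using * code_eqD[of j z j' z'] leaf_in_prefixes by (simp add: ab)
    qed
    then show ?thesis
      by (simp add: T_def card_image card_cartesian_product)
  qed
  ultimately show ?thesis
    using S pres rpts_lightest consistent_lightest stable_lightest symmetric_lightest
    by (intro exI[of _ S] exI[of _ lightest]) auto
qed

end

section \<open>Choice of parameters\<close>

text \<open>Write the power of \<open>n\<close> as \<open>n * n powr (1 - 1 / D)\<close> and bound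
  only the second factor. The two powers of \<open>k\<close> then multiply to \<open>k\<close>, and
  \<open>q\<close> gets the exponent \<open>D * (1 - 1 / D) = D - 1\<close>.\<close>

lemma powr_bound:
  fixes n k q \<sigma> A B :: real and D :: nat
  assumes "n \<le> A * k * q ^ D" "\<sigma> \<le> B * k" "0 \<le> n" "0 \<le> \<sigma>" "1 \<le> A" "1 \<le> B" "0 < k" "0 < q" "1 \<le> D"
  shows "n powr (2 - 1 / D) * \<sigma> powr (1 / D) \<le> A * B * (n * k * q ^ (D - 1))"
proof -
  define a :: real where "a = 1 / D"
  have a: "0 \<le> a" "a \<le> 1"
    using assms by (auto simp: a_def)
  have "n powr (2 - a) = n * n powr (1 - a)"
  proof (cases "n = 0")
    case False
    then show ?thesis
      using assms powr_add[of n 1 "1 - a"] by simp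
  qed simp
  moreover have "n powr (1 - a) \<le> (A * k * q ^ D) powr (1 - a)"
    using assms a by (intro powr_mono2) auto
  moreover have "(A * k * q ^ D) powr (1 - a) = A powr (1 - a) * k powr (1 - a) * q ^ (D - 1)"
  proof -
    have "(q ^ D) powr (1 - a) = q powr (real D * (1 - a))"
      using assms by (simp add: powr_realpow[symmetric] powr_powr)
    also have "real D * (1 - a) = real (D - 1)"
      using assms by (simp add: a_def field_simps of_nat_diff)
    finally have "(q ^ D) powr (1 - a) = q ^ (D - 1)"
      using powr_realpow[OF \<open>0 < q\<close>, of "D - 1"] by (simp only:)
    then show ?thesis
      using assms by (simp add: powr_mult)
  qed
  moreover have "\<sigma> powr a \<le> (B * k) powr a"
    using assms a by (intro powr_mono2) auto
  moreover have "(B * k) powr a = B powr a * k powr a"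
    using assms by (simp add: powr_mult)
  ultimately have "n powr (2 - a) \<le> n * (A powr (1 - a) * k powr (1 - a) * q ^ (D - 1))"
      "\<sigma> powr a \<le> B powr a * k powr a"
    using \<open>0 \<le> n\<close> by (simp_all add: mult_left_mono)
  then have "n powr (2 - a) * \<sigma> powr a
      \<le> (n * (A powr (1 - a) * k powr (1 - a) * q ^ (D - 1))) * (B powr a * k powr a)"
    using assms by (intro mult_mono) auto
  also have "\<dots> = (A powr (1 - a) * B powr a) * (n * (k powr (1 - a) * k powr a) * q ^ (D - 1))"
    by (simp add: mult_ac)
  also have "k powr (1 - a) * k powr a = k"
    using assms by (simp add: powr_add[symmetric])
  also have "(A powr (1 - a) * B powr a) * (n * k * q ^ (D - 1)) \<le> (A * B) * (n * k * q ^ (D - 1))"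
  proof (intro mult_right_mono mult_mono)
    show "A powr (1 - a) \<le> A" "B powr a \<le> B"
      using assms a powr_mono[of "1 - a" 1 A] powr_mono[of a 1 B] by auto
  qed (use assms in auto)
  finally show ?thesis
    by (simp add: a_def)
qed

text \<open>\<open>k\<close> is \<open>\<sigma>\<close>, capped so that \<open>k\<close> tries fit
  into half of the vertices at least for \<open>q = 1\<close>; \<open>q\<close> is then as large as
  this room allows, which keeps \<open>n\<close> within a constant factor of
  \<open>k * q ^ D\<close>.\<close>

lemma parameters:
  fixes C D n \<sigma> :: nat
  assumes "1 \<le> C" "1 \<le> D" "2 * C \<le> n" "\<sigma> \<le> n"
  obtains k q :: nat where "k \<le> \<sigma>" "1 \<le> q" "2 * (k * (C * q ^ D)) \<le> n"
    "real n powr (2 - 1 / D) * real \<sigma> powr (1 / D)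
       \<le> real (2 * C * 2 ^ D * (4 * C)) * (real n * real k * real q ^ (D - 1))"
proof (cases "\<sigma> = 0")
  case True
  \<comment> \<open>\<open>0 powr (1 / D)\<close> is 0, so no trie is required.\<close>
  then show ?thesis
    using assms by (intro that[of 0 1]) auto
next
  case False
  define k where "k = min \<sigma> (n div (2 * C))"
  have "1 \<le> n div (2 * C)"
    using assms div_le_mono[of "2 * C" n "2 * C"] by simp
  then have k: "1 \<le> k" "k \<le> \<sigma>"
    using False by (auto simp: k_def)
  have "2 * C * k \<le> 2 * C * (n div (2 * C))"
    by (intro mult_left_mono) (auto simp: k_def)
  also have "\<dots> \<le> n"
    by simp
  finally have kn: "2 * C * k \<le> n" .
  \<comment> \<open>The cap costs only a constant factor: when it applies,
    \<open>\<sigma> \<le> n < 2 * C * (k + 1) \<le> 4 * C * k\<close>.\<close>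
  have \<sigma>k: "\<sigma> \<le> 4 * C * k"
  proof (cases "\<sigma> \<le> n div (2 * C)")
    case True
    then have "k = \<sigma>"
      by (simp add: k_def)
    then show ?thesis
      using assms by simp
  next
    case False
    then have "k = n div (2 * C)"
      by (simp add: k_def)
    then have "n < 2 * C * (k + 1)"
      using assms dividend_less_times_div[of "2 * C" n] by simp
    also have "\<dots> \<le> 2 * C * (2 * k)"
      using k by (intro mult_left_mono) auto
    finally show ?thesis
      using assms by simp
  qed
  define q where "q = (LEAST q. n < 2 * C * k * (q + 1) ^ D)"
  \<comment> \<open>The value \<open>n\<close> satisfies the condition under \<open>LEAST\<close>,
    so a least one exists.\<close>
  have "n < n + 1"
    by simp
  also have "n + 1 \<le> (n + 1) ^ D"
    using assms by (intro self_le_power) auto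
  also have "\<dots> \<le> 2 * C * k * (n + 1) ^ D"
    using assms k by simp
  finally have q: "n < 2 * C * k * (q + 1) ^ D"
    unfolding q_def by (rule LeastI)
  have q1: "1 \<le> q"
  proof (rule ccontr)
    assume "\<not> ?thesis"
    then have "q = 0" by simp
    then show False
      using q kn by simp
  qed
  then have "\<not> n < 2 * C * k * (q - 1 + 1) ^ D"
    using not_less_Least[of "q - 1" "\<lambda>q. n < 2 * C * k * (q + 1) ^ D"] by (simp add: q_def)
  then have qn: "2 * C * k * q ^ D \<le> n"
    using q1 by simp
  note q
  also have "2 * C * k * (q + 1) ^ D \<le> 2 * C * k * (2 * q) ^ D"
    using q1 by (intro mult_left_mono power_mono) auto
  finally have "n \<le> (2 * C * 2 ^ D) * k * q ^ D"
    by (simp add: power_mult_distrib mult_ac)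
  then have n_le: "real n \<le> real (2 * C * 2 ^ D) * real k * real q ^ D"
    by (metis of_nat_le_iff of_nat_mult of_nat_power)
  have \<sigma>_le: "real \<sigma> \<le> real (4 * C) * real k"
    using \<sigma>k by (metis of_nat_le_iff of_nat_mult)
  have A: "1 \<le> real (2 * C * 2 ^ D)"
  proof -
    have "1 \<le> 2 * C * 2 ^ D"
      using assms by simp
    then show ?thesis
      by (metis of_nat_1 of_nat_le_iff)
  qed
  show ?thesis
  proof (rule that[of k q])
    show "2 * (k * (C * q ^ D)) \<le> n"
      using qn by (simp add: mult_ac)
    show "real n powr (2 - 1 / D) * real \<sigma> powr (1 / D)
       \<le> real (2 * C * 2 ^ D * (4 * C)) * (real n * real k * real q ^ (D - 1))"
      using powr_bound[OF n_le \<sigma>_le] A assms k q1 by (simp add: mult_ac)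
  qed (use k q1 in auto)
qed

lemma dense_instance:
  fixes ed :: "nat \<Rightarrow> nat \<Rightarrow> 'e" and f n \<sigma> :: nat
  defines "C \<equiv> 2 * f + 1" and "D \<equiv> 2 ^ f"
  assumes ed_eq: "\<And>u v u' v'. ed u v = ed u' v' \<Longrightarrow> u = u' \<and> v = v' \<or> u = v' \<and> v = u'"
    and "2 * C \<le> n" "\<sigma> \<le> n"
  shows "\<exists>A S \<pi>. A \<subseteq> {..<n} \<times> {..<n} \<and> (\<forall>v. (v, v) \<notin> A) \<and> S \<subseteq> {..<n} \<and> card S = \<sigma> \<and>
    rpts ed {..<n} (case_prod ed ` A) \<pi> \<and> rpts_consistent {..<n} (case_prod ed ` A) \<pi> \<and>
    rpts_stable ed {..<n} (case_prod ed ` A) \<pi> \<and>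
    ((\<forall>u v. ed u v = ed v u) \<longrightarrow> rpts_symmetric {..<n} (case_prod ed ` A) \<pi>) \<and>
    ft_preserver ed f {..<n} (case_prod ed ` A) S (overlay ed f {..<n} (case_prod ed ` A) S \<pi>) \<and>
    1 / (2 * real (2 * C * 2 ^ D * (4 * C))) * real n powr (2 - 1 / 2 ^ f) * real \<sigma> powr (1 / 2 ^ f)
      \<le> real (card (overlay ed f {..<n} (case_prod ed ` A) S \<pi>))"
proof -
  obtain k q :: nat where kq: "k \<le> \<sigma>" "1 \<le> q" "2 * (k * (C * q ^ D)) \<le> n"
    "real n powr (2 - 1 / D) * real \<sigma> powr (1 / D)
       \<le> real (2 * C * 2 ^ D * (4 * C)) * (real n * real k * real q ^ (D - 1))"
    using parameters[of C D n \<sigma>] assms by (auto simp: C_def D_def)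
  obtain L :: "bool list set" and h rank where L: "finite L" "\<forall>z\<in>L. length z = h"
    "cuttable f L rank" "card L = q ^ (D - 1)" "card (prefixes_of L) \<le> C * q ^ D"
    using ex_cuttable[OF kq(2), of f] unfolding C_def D_def by blast
  have "L \<noteq> {}"
    using L(4) kq(2) by auto
  let ?K = "k * card (prefixes_of L)"
  have "2 * ?K \<le> 2 * (k * (C * q ^ D))"
    using L(5) by simp
  then have K: "2 * ?K \<le> n"
    using kq(3) by linarith
  have "card ({..<k} \<times> prefixes_of L) = card {..<?K}" "finite ({..<k} \<times> prefixes_of L)"
    using finite_prefixes_of[OF L(1)] by (auto simp: card_cartesian_product)
  then obtain code where "bij_betw code ({..<k} \<times> prefixes_of L) {..<?K}"
    using finite_same_card_bij[of "{..<k} \<times> prefixes_of L" "{..<?K}"] by blast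
  then interpret trie_graph ed L rank code f h k n
  proof unfold_locales
    show "u = u' \<and> v = v' \<or> u = v' \<and> v = u'" if "ed u v = ed u' v'" for u v u' v'
      using that by (rule ed_eq)
  qed (use L K \<open>L \<noteq> {}\<close> in auto)
  obtain S \<pi> where S: "S \<subseteq> {..<n}" "card S = \<sigma>"
    "rpts ed {..<n} edges \<pi>" "rpts_consistent {..<n} edges \<pi>" "rpts_stable ed {..<n} edges \<pi>"
    "(\<forall>u v. ed u v = ed v u) \<longrightarrow> rpts_symmetric {..<n} edges \<pi>"
    "ft_preserver ed f {..<n} edges S (overlay ed f {..<n} edges S \<pi>)"
    "k * card L * (n - ?K) \<le> card (overlay ed f {..<n} edges S \<pi>)"
    using dense_overlay[OF kq(1) \<open>\<sigma> \<le> n\<close>] by blast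
  define G where "G = real (2 * C * 2 ^ D * (4 * C))"
  have "G > 0"
    unfolding G_def C_def of_nat_0_less_iff by simp
  have "1 / (2 * G) * (real n powr (2 - 1 / D) * real \<sigma> powr (1 / D))
      \<le> 1 / (2 * G) * (G * (real n * real k * real q ^ (D - 1)))"
    using kq(4) \<open>G > 0\<close> unfolding G_def by (intro mult_left_mono) auto
  also have "\<dots> = real k * real q ^ (D - 1) * (real n / 2)"
    using \<open>G > 0\<close> by simp
  also have "\<dots> \<le> real k * real q ^ (D - 1) * real (n - ?K)"
  proof (intro mult_left_mono)
    \<comment> \<open>The tries occupy at most half of the vertices, so \<open>X\<close> has at
      least \<open>n / 2\<close>; this is the extra factor 2 in the constant.\<close>
    have "n \<le> 2 * (n - ?K)"
      using K by linarith
    then have "real n \<le> real (2 * (n - ?K))"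
      by (simp only: of_nat_le_iff)
    then show "real n / 2 \<le> real (n - ?K)"
      unfolding of_nat_mult of_nat_numeral by linarith
  qed simp
  also have "\<dots> = real (k * card L * (n - ?K))"
    by (simp add: L(4))
  also have "\<dots> \<le> real (card (overlay ed f {..<n} edges S \<pi>))"
    using S(8) of_nat_le_iff by blast
  finally have "1 / (2 * G) * real n powr (2 - 1 / 2 ^ f) * real \<sigma> powr (1 / 2 ^ f)
      \<le> real (card (overlay ed f {..<n} edges S \<pi>))"
    by (simp add: D_def mult_ac)
  moreover have "(v, v) \<notin> arcs" for v
    using level_arc by fastforce
  ultimately show ?thesis
    using S arcs_subset unfolding edges_def G_def by blast
qed

lemma uedge_eqD: "uedge u v = uedge u' v' \<Longrightarrow> u = u' \<and> v = v' \<or> u = v' \<and> v = u'"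
  by (simp add: uedge_def doubleton_eq_iff)

theorem theorem19:
  fixes f :: nat
  shows "\<exists>c>0::real. \<exists>N::nat. \<forall>n\<ge>N. \<forall>\<sigma>\<le>n.
    (\<exists>(V :: nat set) (E :: nat set set) S \<pi>.
       ugraph V E \<and> card V = n \<and> S \<subseteq> V \<and> card S = \<sigma> \<and>
       rpts uedge V E \<pi> \<and> rpts_consistent V E \<pi> \<and> rpts_stable uedge V E \<pi> \<and>
       rpts_symmetric V E \<pi> \<and>
       ft_preserver uedge f V E S (overlay uedge f V E S \<pi>) \<and>
       real (card (overlay uedge f V E S \<pi>))
         \<ge> c * real n powr (2 - 1 / 2 ^ f) * real \<sigma> powr (1 / 2 ^ f)) \<and>
    (\<exists>(V :: nat set) (E :: (nat \<times> nat) set) S \<pi>.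
       digraph V E \<and> card V = n \<and> S \<subseteq> V \<and> card S = \<sigma> \<and>
       rpts Pair V E \<pi> \<and> rpts_consistent V E \<pi> \<and> rpts_stable Pair V E \<pi> \<and>
       ft_preserver Pair f V E S (overlay Pair f V E S \<pi>) \<and>
       real (card (overlay Pair f V E S \<pi>))
         \<ge> c * real n powr (2 - 1 / 2 ^ f) * real \<sigma> powr (1 / 2 ^ f))"
proof -
  \<comment> \<open>\<open>C * q ^ 2 ^ f\<close> bounds the nodes of one trie, so from
    \<open>n = 2 * C\<close> on one copy with \<open>q = 1\<close> fits into half of the
    vertices.\<close>
  define C :: nat where "C = 2 * f + 1"
  define c where "c = 1 / (2 * real (2 * C * 2 ^ 2 ^ f * (4 * C)))"
  have "0 < real (2 * C * 2 ^ 2 ^ f * (4 * C))"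
    unfolding C_def of_nat_0_less_iff by simp
  then have "c > 0"
    unfolding c_def by simp
  have main: "(\<exists>(V :: nat set) (E :: nat set set) S \<pi>.
       ugraph V E \<and> card V = n \<and> S \<subseteq> V \<and> card S = \<sigma> \<and>
       rpts uedge V E \<pi> \<and> rpts_consistent V E \<pi> \<and> rpts_stable uedge V E \<pi> \<and>
       rpts_symmetric V E \<pi> \<and>
       ft_preserver uedge f V E S (overlay uedge f V E S \<pi>) \<and>
       real (card (overlay uedge f V E S \<pi>))
         \<ge> c * real n powr (2 - 1 / 2 ^ f) * real \<sigma> powr (1 / 2 ^ f))"
    (is ?undirected)
    "(\<exists>(V :: nat set) (E :: (nat \<times> nat) set) S \<pi>.
       digraph V E \<and> card V = n \<and> S \<subseteq> V \<and> card S = \<sigma> \<and>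
       rpts Pair V E \<pi> \<and> rpts_consistent V E \<pi> \<and> rpts_stable Pair V E \<pi> \<and>
       ft_preserver Pair f V E S (overlay Pair f V E S \<pi>) \<and>
       real (card (overlay Pair f V E S \<pi>))
         \<ge> c * real n powr (2 - 1 / 2 ^ f) * real \<sigma> powr (1 / 2 ^ f))"
    (is ?directed)
    if bounds: "2 * C \<le> n" "\<sigma> \<le> n" for n \<sigma>
  proof -
    obtain A S \<pi> where A: "A \<subseteq> {..<n} \<times> {..<n}" "\<forall>v. (v, v) \<notin> A" "S \<subseteq> {..<n}" "card S = \<sigma>"
      "rpts uedge {..<n} (case_prod uedge ` A) \<pi>" "rpts_consistent {..<n} (case_prod uedge ` A) \<pi>"
      "rpts_stable uedge {..<n} (case_prod uedge ` A) \<pi>"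
      "(\<forall>u v :: nat. uedge u v = uedge v u) \<longrightarrow> rpts_symmetric {..<n} (case_prod uedge ` A) \<pi>"
      "ft_preserver uedge f {..<n} (case_prod uedge ` A) S
         (overlay uedge f {..<n} (case_prod uedge ` A) S \<pi>)"
      "c * real n powr (2 - 1 / 2 ^ f) * real \<sigma> powr (1 / 2 ^ f)
        \<le> real (card (overlay uedge f {..<n} (case_prod uedge ` A) S \<pi>))"
      using dense_instance[of uedge f n \<sigma>, OF uedge_eqD bounds[unfolded C_def]]
      unfolding C_def c_def by blast
    have "ugraph {..<n} (case_prod uedge ` A)"
      unfolding ugraph_def
    proof (intro conjI ballI)
      fix e
      assume "e \<in> case_prod uedge ` A"
      then obtain u v where "(u, v) \<in> A" "e = {u, v}"
        by (auto simp: uedge_def)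
      moreover from this have "u \<noteq> v"
        using A(2) by auto
      ultimately show "e \<subseteq> {..<n}" "card e = 2"
        using A(1) by auto
    qed simp
    moreover have "uedge u v = uedge v u" for u v :: nat
      by (auto simp: uedge_def)
    ultimately show ?undirected
      using A by (intro exI[of _ "{..<n}"] exI[of _ "case_prod uedge ` A"] exI[of _ S] exI[of _ \<pi>]) simp
  next
    obtain A S \<pi> where A: "A \<subseteq> {..<n} \<times> {..<n}" "\<forall>v. (v, v) \<notin> A" "S \<subseteq> {..<n}" "card S = \<sigma>"
      "rpts Pair {..<n} (case_prod Pair ` A) \<pi>" "rpts_consistent {..<n} (case_prod Pair ` A) \<pi>"
      "rpts_stable Pair {..<n} (case_prod Pair ` A) \<pi>"
      "ft_preserver Pair f {..<n} (case_prod Pair ` A) S (overlay Pair f {..<n} (case_prod Pair ` A) S \<pi>)"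
      "c * real n powr (2 - 1 / 2 ^ f) * real \<sigma> powr (1 / 2 ^ f)
        \<le> real (card (overlay Pair f {..<n} (case_prod Pair ` A) S \<pi>))"
      using dense_instance[of Pair f n \<sigma>, OF _ bounds[unfolded C_def]]
      unfolding C_def c_def by blast
    then show ?directed
      by (intro exI[of _ "{..<n}"] exI[of _ A] exI[of _ S] exI[of _ \<pi>]) (simp add: digraph_def)
  qed
  then show ?thesis
    using \<open>c > 0\<close> by (intro exI[of _ c] exI[of _ "2 * C"] conjI allI impI) simp_all
qed

end
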